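(* Let $0<p_1,p_2<\infty$, $0<q_1,q_2\le\infty$ and $I=(0,1)$ or $I=(0,\infty)$. (i) If either $p_1<p_2$, or $p_1=p_2$ and $q_1>q_2$, then $M(L^{p_1,q_1},L^{p_2,q_2})=\{0\}$. (ii) If either $p_1>p_2$, or $p_1=p_2$ and $q_1\le q_2$, then $$M(L^{p_1,q_1},L^{p_2,q_2})=L^{p_3,q_3}$$ (equal as sets, with equivalent quasi-norms), where $$\frac1{p_3}=\frac1{p_2}-\frac1{p_1}\quad\text{and}\quad\frac1{q_3}=\begin{cases}\frac1{q_2}-\frac1{q_1}&\text{if }q_1>q_2,\\0&\text{if }q_1\le q_2.\end{cases}$$
   Context: $I$ carries Lebesgue measure $m$; $L^0(I)$ is the space of (classes of) real measurable functions on $I$, and $x^*(t)=\inf\{\lambda>0: m\{|x|>\lambda\}\le t\}$ is the nonincreasing rearrangement. The Lorentz space $L^{p,q}=L^{p,q}(I)$, $0<p,q\le\infty$, consists of all $x\in L^0(I)$ with $\|x\|_{p,q}<\infty$, where $\|x\|_{p,q}=\left(\int_0^{m(I)}[t^{1/p}x^*(t)]^q\frac{dt}t\right)^{1/q}$ for $0<q<\infty$ and $\|x\|_{p,\infty}=\sup_{0<t<m(I)}t^{1/p}x^*(t)$ for $q=\infty$. Conventions: $1/\infty=0$, and $1/p_3=0$ (resp. $1/q_3=0$) means $p_3=\infty$ (resp. $q_3=\infty$); thus $L^{\infty,\infty}=L^\infty$. For quasi-normed function spaces $E,F\subset L^0(I)$, the space of pointwise multipliers is $M(E,F)=\{x\in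 L^0(I):xy\in F\text{ for each }y\in E\}$ with $\|x\|_{M(E,F)}=\sup_{\|y\|_E=1}\|xy\|_F$. *)

theory Defs
  imports "HOL-Analysis.Analysis"
begin

text \<open>
  Functions are represented by measurable representatives \<open>real \<Rightarrow> real\<close>, whose values outside
  \<open>I\<close> are irrelevant. All norms and spaces below are invariant under a.e. equality on \<open>I\<close>, so
  equalities of sets of representatives are equalities of sets of a.e. classes.
  Exponents lie in \<open>ennreal\<close>, where \<open>1 / \<infinity> = 0\<close>; quasi-norms are \<open>ennreal\<close>-valued.
\<close>

definition L0 :: "real set \<Rightarrow> (real \<Rightarrow> real) set" where
  "L0 I = borel_measurable (lebesgue_on I)"

text \<open>Real powers on \<open>[0,\<infinity>]\<close>; only meant for exponents \<open>r > 0\<close>.\<close>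

definition epowr :: "ennreal \<Rightarrow> real \<Rightarrow> ennreal" where
  "epowr a r = (if a = \<infinity> then \<infinity> else ennreal (enn2real a powr r))"

text \<open>The infimum is \<open>\<infinity>\<close> if no \<open>c\<close> qualifies.\<close>

definition rearrangement :: "real set \<Rightarrow> (real \<Rightarrow> real) \<Rightarrow> real \<Rightarrow> ennreal" where
  "rearrangement I x t =
     Inf (ennreal ` {c. 0 < c \<and> emeasure (lebesgue_on I) {s \<in> I. c < \<bar>x s\<bar>} \<le> ennreal t})"

definition lorentz_norm :: "real set \<Rightarrow> ennreal \<Rightarrow> ennreal \<Rightarrow> (real \<Rightarrow> real) \<Rightarrow> ennreal" where
  "lorentz_norm I p q x =
     (let J = {t. 0 < t \<and> ennreal t < emeasure lebesgue I};
          g = (\<lambda>t. ennreal (t powr enn2real (1 / p)) * rearrangement I x t)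
      in if q = \<infinity> then (SUP t\<in>J. g t)
         else epowr (\<integral>\<^sup>+t\<in>J. (epowr (g t) (enn2real q) / ennreal t) \<partial>lebesgue) (1 / enn2real q))"

definition lorentz :: "real set \<Rightarrow> ennreal \<Rightarrow> ennreal \<Rightarrow> (real \<Rightarrow> real) set" where
  "lorentz I p q = {x \<in> L0 I. lorentz_norm I p q x < \<infinity>}"

definition multipliers ::
  "real set \<Rightarrow> (real \<Rightarrow> real) set \<Rightarrow> (real \<Rightarrow> real) set \<Rightarrow> (real \<Rightarrow> real) set" where
  "multipliers I E F = {x \<in> L0 I. \<forall>y\<in>E. (\<lambda>t. x t * y t) \<in> F}"

definition multiplier_norm ::
  "(real \<Rightarrow> real) set \<Rightarrow> ((real \<Rightarrow> real) \<Rightarrow> ennreal) \<Rightarrow> ((real \<Rightarrow> real) \<Rightarrow> ennreal)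
    \<Rightarrow> (real \<Rightarrow> real) \<Rightarrow> ennreal" where
  "multiplier_norm E normE normF x = (SUP y\<in>{y \<in> E. normE y = 1}. normF (\<lambda>t. x t * y t))"

definition equivalent_on ::
  "(real \<Rightarrow> real) set \<Rightarrow> ((real \<Rightarrow> real) \<Rightarrow> ennreal) \<Rightarrow> ((real \<Rightarrow> real) \<Rightarrow> ennreal) \<Rightarrow> bool" where
  "equivalent_on X N N' \<longleftrightarrow>
     (\<exists>c C :: real. 0 < c \<and> 0 < C \<and>
        (\<forall>x\<in>X. ennreal c * N' x \<le> N x \<and> N x \<le> ennreal C * N' x))"

end

theory Submission
  imports Defs
begin

text \<open>
  Sampling \<open>t\<^sup>1\<^sup>/\<^sup>p x\<^sup>*(t)\<close> at the powers \<open>t = 2\<^sup>k\<close> shows that \<open>\<parallel>x\<parallel>\<^sub>p\<^sub>,\<^sub>q\<close> is equivalent to the \<open>\<ell>\<^sup>q\<close> quasi-norm of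
  the sequence \<open>2\<^sup>k\<^sup>/\<^sup>p x\<^sup>*(2\<^sup>k)\<close>. Hoelder's inequality for sequences and \<open>(xy)\<^sup>*(2t) \<le> x\<^sup>*(t) y\<^sup>*(t)\<close> then
  give the inclusion of \<open>L\<^sup>p\<^sup>3\<^sup>,\<^sup>q\<^sup>3\<close> in the multiplier space. Conversely, a multiplier \<open>x\<close> is tested on
  step functions with values \<open>b\<^sub>k\<close> on disjoint sets of measure \<open>2\<^sup>k\<^sup>-\<^sup>1\<close> where \<open>\<bar>x\<bar>\<close> is about \<open>x\<^sup>*(2\<^sup>k)\<close>.
  The quasi-norm of such a step function is equivalent to the \<open>\<ell>\<^sup>q\<close> quasi-norm of \<open>2\<^sup>k\<^sup>/\<^sup>p b\<^sub>k\<close> for arbitrary,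
  not necessarily monotone, coefficients, so both parts reduce to multipliers between \<open>\<ell>\<^sup>q\<close> spaces.
  That a multiplier has finite multiplier norm is a uniform boundedness argument: if unit vectors
  \<open>y\<^sub>n\<close> made \<open>\<parallel>x y\<^sub>n\<parallel>\<close> grow too fast, then \<open>sup\<^sub>n c\<^sub>n \<bar>y\<^sub>n\<bar>\<close> with geometric weights would be in the domain, but
  its product with \<open>x\<close> would not be in the target.
\<close>

section \<open>Powers and sequence quasi-norms\<close>

lemma epowr_ennreal [simp]: "0 \<le> a \<Longrightarrow> epowr (ennreal a) r = ennreal (a powr r)"
  by (simp add: epowr_def)

lemma epowr_top [simp]: "epowr top r = top"
  by (simp add: epowr_def)

lemma epowr_zero [simp]: "epowr 0 r = 0"
  by (simp add: epowr_def)

lemma epowr_one_left [simp]: "epowr 1 r = 1"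
  by (simp add: epowr_def)

lemma epowr_one_right [simp]: "epowr a 1 = a"
  by (cases a) auto

lemma epowr_mono: "0 \<le> r \<Longrightarrow> a \<le> b \<Longrightarrow> epowr a r \<le> epowr b r"
  by (cases a; cases b) (auto intro!: ennreal_leI powr_mono2 simp: top_unique)

text \<open>The conventions \<open>0 * top = 0\<close> and \<open>0 powr r = 0\<close> make this
  hold for every real \<open>r\<close>. With a factor \<open>top\<close>, the point is that a
  nonzero cofactor keeps a nonzero power.\<close>

lemma epowr_mult: "epowr (a * b) r = epowr a r * epowr b r"
proof (cases "a = 0 \<or> b = 0")
  case False
  then have "\<And>c. c \<in> {a, b} \<Longrightarrow> epowr c r \<noteq> 0"
    by (auto simp: epowr_def enn2real_eq_0_iff)
  with False show ?thesis
    by (cases a; cases b)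
       (auto simp: ennreal_mult_top ennreal_top_mult ennreal_mult[symmetric] powr_mult)
qed auto

lemma epowr_epowr: "epowr (epowr a r) s = epowr a (r * s)"
  by (cases a) (auto simp: powr_powr)

lemma epowr_add: "epowr a (r + s) = epowr a r * epowr a s"
  by (cases a) (auto simp: powr_add ennreal_mult)

lemma epowr_le_cancel: "0 < r \<Longrightarrow> epowr a r \<le> epowr b r \<longleftrightarrow> a \<le> b"
  using epowr_mono[of r a b] epowr_mono[of "1 / r" "epowr a r" "epowr b r"]
  by (auto simp: epowr_epowr)

lemma epowr_antimono_exponent: "a \<le> 1 \<Longrightarrow> r \<le> s \<Longrightarrow> epowr a s \<le> epowr a r"
  by (cases a) (auto intro!: ennreal_leI powr_mono' simp: top_unique)

lemma borel_measurable_epowr [measurable (raw)]: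
  "f \<in> borel_measurable M \<Longrightarrow> (\<lambda>x. epowr (f x) r) \<in> borel_measurable M"
proof -
  assume f [measurable]: "f \<in> borel_measurable M"
  have [measurable]: "{x \<in> space M. f x = \<infinity>} \<in> sets M"
    using measurable_sets[OF f, of "{\<infinity>}"] by (simp add: vimage_def Int_def conj_commute)
  show ?thesis
    unfolding epowr_def by measurable
qed

section \<open>Sequence quasi-norms over an index set, with counting measure as unordered
  sum\<close>

definition lnorm :: "ennreal \<Rightarrow> 'a set \<Rightarrow> ('a \<Rightarrow> ennreal) \<Rightarrow> ennreal" where
  "lnorm q S a = (if q = \<infinity> then (SUP k\<in>S. a k)
     else epowr (\<integral>\<^sup>+k. epowr (a k) (enn2real q) \<partial>count_space S) (1 / enn2real q))"

lemma lnorm_top: "lnorm top S a = (SUP k\<in>S. a k)"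
  by (simp add: lnorm_def)

lemma lnorm_ennreal:
  "0 < r \<Longrightarrow> lnorm (ennreal r) S a = epowr (\<integral>\<^sup>+k. epowr (a k) r \<partial>count_space S) (1 / r)"
  by (simp add: lnorm_def)

text \<open>Removes the outer root, so that bounds for finite exponents become bounds on sums of
  powers.\<close>

lemma lnorm_ennreal_le_iff:
  assumes "0 < r"
  shows "lnorm (ennreal r) S a \<le> B \<longleftrightarrow> (\<integral>\<^sup>+k. epowr (a k) r \<partial>count_space S) \<le> epowr B r"
proof -
  have "B = epowr (epowr B r) (1 / r)"
    using assms by (simp add: epowr_epowr)
  then show ?thesis
    using assms by (metis lnorm_ennreal epowr_le_cancel zero_less_divide_1_iff)
qed

lemma ennreal_exponent_cases [consumes 1, case_names top real]:
  assumes "(0::ennreal) < q"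
  obtains "q = top" | r where "0 < r" "q = ennreal r"
  using assms by (cases q) auto

lemma lnorm_mono:
  assumes "0 < q" "\<And>k. k \<in> S \<Longrightarrow> a k \<le> b k"
  shows "lnorm q S a \<le> lnorm q S b"
  using assms(1)
proof (cases rule: ennreal_exponent_cases)
  case top
  then show ?thesis using assms by (auto simp: lnorm_top intro!: SUP_mono)
next
  case (real r)
  then show ?thesis using assms
    by (auto simp: lnorm_ennreal intro!: epowr_mono nn_integral_mono)
qed

lemma lnorm_cong: "(\<And>k. k \<in> S \<Longrightarrow> a k = b k) \<Longrightarrow> lnorm q S a = lnorm q S b"
  by (auto simp: lnorm_def cong: nn_integral_cong_simp SUP_cong_simp
        intro!: arg_cong2[where f = epowr] nn_integral_cong SUP_cong)

lemma lnorm_cmult: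
  assumes "0 < q"
  shows "lnorm q S (\<lambda>k. c * a k) = c * lnorm q S a"
  using assms
proof (cases rule: ennreal_exponent_cases)
  case top
  then show ?thesis by (simp add: lnorm_top SUP_mult_left_ennreal)
next
  case (real r)
  then show ?thesis
    by (simp add: lnorm_ennreal epowr_mult nn_integral_cmult epowr_epowr)
qed

text \<open>Mostly applied to translations of the dyadic index; a shift can only lose terms.\<close>

lemma lnorm_inj:
  assumes "0 < q" "inj_on f S" "f ` S \<subseteq> T"
  shows "lnorm q S (\<lambda>k. a (f k)) \<le> lnorm q T a"
  using assms(1)
proof (cases rule: ennreal_exponent_cases)
  case top
  then show ?thesis using assms by (auto simp: lnorm_top intro!: SUP_mono)
next
  case (real r)
  have "(\<integral>\<^sup>+k. epowr (a (f k)) r \<partial>count_space S) = (\<integral>\<^sup>+k. epowr (a k) r \<partial>count_space (f ` S))"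
    using assms by (intro nn_integral_bij_count_space) (auto simp: bij_betw_def)
  also have "\<dots> \<le> (\<integral>\<^sup>+k. epowr (a k) r \<partial>count_space T)"
    using assms(3) by (auto simp: nn_integral_count_space_indicator[of "f ` S"]
        nn_integral_count_space_indicator[of T] image_subset_iff
        intro!: nn_integral_mono split: split_indicator)
  finally show ?thesis using real
    by (auto simp: lnorm_ennreal intro!: epowr_mono)
qed

lemma lnorm_le_zero_outside:
  assumes "0 < q" "S \<subseteq> T" "\<And>k. k \<in> T - S \<Longrightarrow> a k = 0"
  shows "lnorm q T a \<le> lnorm q S a"
  using assms(1)
proof (cases rule: ennreal_exponent_cases)
  case top
  then show ?thesis using assms
    by (auto simp: lnorm_top intro!: SUP_least) (metis DiffI SUP_upper zero_le)
next
  case (real r)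
  have "(\<integral>\<^sup>+k. epowr (a k) r \<partial>count_space T) = (\<integral>\<^sup>+k. epowr (a k) r \<partial>count_space S)"
    using assms by (intro nn_integral_count_space_eq) auto
  then show ?thesis using real by (simp add: lnorm_ennreal)
qed

lemma lnorm_ge_point:
  assumes "0 < q" "k \<in> S"
  shows "a k \<le> lnorm q S a"
  using assms(1)
proof (cases rule: ennreal_exponent_cases)
  case top
  then show ?thesis using assms by (auto simp: lnorm_top intro!: SUP_upper)
next
  case (real r)
  have "epowr (epowr (a k) r) (1 / r) \<le> lnorm q S a"
    using real assms nn_integral_ge_point[of k S "\<lambda>k. epowr (a k) r"]
    by (auto simp: lnorm_ennreal intro!: epowr_mono)
  then show ?thesis using real by (simp add: epowr_epowr)
qed

lemma lnorm_finite_less_top: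
  assumes "0 < q" "finite F" "\<And>k. k \<in> F \<Longrightarrow> a k < top"
  shows "lnorm q F a < top"
  using assms(1)
proof (cases rule: ennreal_exponent_cases)
  case top
  then show ?thesis using assms
    by (cases "F = {}") (auto simp: lnorm_top bot_ennreal intro!: finite_imp_Sup_less)
next
  case (real r)
  have "epowr (a k) r < top" if "k \<in> F" for k
    using assms(3)[OF that] by (auto simp: epowr_def)
  then have "(\<Sum>k\<in>F. epowr (a k) r) < top"
    by (simp add: ennreal_sum_less_top assms less_top)
  with real assms show ?thesis
    by (auto simp: lnorm_ennreal nn_integral_count_space_finite epowr_def)
qed

text \<open>The elements of \<open>S\<close> with code at most \<open>n\<close> form an increasing
  exhaustion by finite sets, and monotone convergence carries the bound to the limit.\<close>

lemma nn_integral_count_space_le_if_finite_le: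
  fixes f :: "'a::countable \<Rightarrow> ennreal"
  assumes "\<And>F. finite F \<Longrightarrow> F \<subseteq> S \<Longrightarrow> sum f F \<le> B"
  shows "(\<integral>\<^sup>+k. f k \<partial>count_space S) \<le> B"
proof -
  define F where "F n = {k \<in> S. to_nat k \<le> n}" for n
  have fin: "finite (F n)" for n
    by (rule finite_vimageI[of "{..n}" to_nat, THEN finite_subset[rotated]]) (auto simp: F_def)
  have lim: "(SUP n. f k * indicator (F n) k) = f k" if "k \<in> S" for k
    using that by (intro antisym SUP_least SUP_upper2[of "to_nat k"])
      (auto simp: F_def split: split_indicator)
  have "(\<integral>\<^sup>+k. f k \<partial>count_space S) = (\<integral>\<^sup>+k. (SUP n. f k * indicator (F n) k) \<partial>count_space S)"
    by (intro nn_integral_cong) (simp add: lim)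
  also have "\<dots> = (SUP n. (\<integral>\<^sup>+k. f k * indicator (F n) k \<partial>count_space S))"
    by (intro nn_integral_monotone_convergence_SUP)
       (auto simp: incseq_def le_fun_def F_def split: split_indicator)
  also have "\<dots> \<le> B"
  proof (rule SUP_least)
    fix n
    have "(\<integral>\<^sup>+k. f k * indicator (F n) k \<partial>count_space S) = (\<Sum>k\<in>F n. f k * indicator (F n) k)"
      by (intro nn_integral_count_space' fin) (auto simp: F_def)
    also have "\<dots> = sum f (F n)"
      by (intro sum.cong) auto
    also have "\<dots> \<le> B"
      by (intro assms fin) (auto simp: F_def)
    finally show "(\<integral>\<^sup>+k. f k * indicator (F n) k \<partial>count_space S) \<le> B" .
  qed
  finally show ?thesis .
qed

text \<open>Test functions are built on finitely many blocks only; this passes their uniform bounds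
  to the whole dyadic sequence.\<close>

lemma lnorm_le_if_finite_le:
  fixes S :: "'a::countable set"
  assumes "0 < q" "\<And>F. finite F \<Longrightarrow> F \<subseteq> S \<Longrightarrow> lnorm q F a \<le> B"
  shows "lnorm q S a \<le> B"
  using assms(1)
proof (cases rule: ennreal_exponent_cases)
  case top
  have "a k \<le> B" if "k \<in> S" for k
    using assms(2)[of "{k}"] that top by (simp add: lnorm_top)
  then show ?thesis using top by (auto simp: lnorm_top intro!: SUP_least)
next
  case (real r)
  have "(\<Sum>k\<in>F. epowr (a k) r) \<le> epowr B r" if "finite F" "F \<subseteq> S" for F
    using assms(2)[OF that] real that by (simp add: lnorm_ennreal_le_iff nn_integral_count_space_finite)
  then show ?thesis using real
    by (simp add: lnorm_ennreal_le_iff nn_integral_count_space_le_if_finite_le)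
qed

text \<open>The bound 1 on the quasi-norm forces every entry to be at most 1, and powers of such
  numbers decrease in the exponent.\<close>

lemma lnorm_exponent_mono:
  assumes "0 < q1" "q1 \<le> q2" "lnorm q1 S a \<le> 1"
  shows "lnorm q2 S a \<le> 1"
proof -
  have le1: "a k \<le> 1" if "k \<in> S" for k
    using lnorm_ge_point[of q1 k S a] assms that by (auto intro: order_trans)
  have "0 < q2" using assms by auto
  then show ?thesis
  proof (cases rule: ennreal_exponent_cases)
    case top
    then show ?thesis using le1 by (auto simp: lnorm_top intro!: SUP_least)
  next
    case (real r2)
    then obtain r1 where r1: "0 < r1" "q1 = ennreal r1" "r1 \<le> r2"
      using assms by (cases q1) (auto simp: top_unique)
    have "(\<integral>\<^sup>+k. epowr (a k) r2 \<partial>count_space S) \<le> (\<integral>\<^sup>+k. epowr (a k) r1 \<partial>count_space S)"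
      using r1 le1 by (auto intro!: nn_integral_mono epowr_antimono_exponent)
    then show ?thesis
      using assms r1 real by (auto simp: lnorm_ennreal_le_iff)
  qed
qed

text \<open>The three regimes of multipliers between sequence spaces: bounded sequences when
  \<open>q1 \<le> q2\<close>, the target exponent itself when \<open>q1\<close> is infinite, and the
  Hoelder relation between finite exponents.\<close>

lemma dual_exponent_cases:
  fixes q1 q2 q3 :: ennreal
  assumes "0 < q1" "0 < q2" "1 / q3 = (if q1 > q2 then 1 / q2 - 1 / q1 else 0)"
  obtains "q1 \<le> q2" "q3 = top"
  | r where "0 < r" "q1 = top" "q2 = ennreal r" "q3 = ennreal r"
  | r1 r2 r3 where "0 < r1" "0 < r2" "0 < r3" "q1 = ennreal r1" "q2 = ennreal r2" "q3 = ennreal r3"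
      "1 / r2 = 1 / r3 + 1 / r1"
proof (cases "q1 > q2")
  case False
  then show ?thesis using assms(3) that(1) by (simp add: ennreal_divide_eq_0_iff)
next
  case True
  then obtain r2 where r2: "0 < r2" "q2 = ennreal r2"
    using assms by (cases q2) auto
  have q3: "q3 = ennreal (1 / s)" if "1 / q3 = ennreal s" "0 < s" for s
  proof (cases q3)
    case (real r)
    with that have "0 < r" by (cases "r = 0") (auto simp: divide_ennreal_def)
    with real that have "1 / r = s"
      by (simp add: divide_ennreal flip: ennreal_1)
    with real show ?thesis by auto
  qed (use that in \<open>auto simp: divide_ennreal_def\<close>)
  have inv2: "1 / q2 = ennreal (1 / r2)"
    using r2 by (simp add: divide_ennreal flip: ennreal_1)
  show ?thesis
  proof (cases q1)
    case top
    then have "1 / q3 = ennreal (1 / r2)"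
      using assms(3) True inv2 by (simp add: divide_ennreal_def)
    with q3[OF this] r2 top that(2) show ?thesis by simp
  next
    case (real r1)
    then have r1: "0 < r1" "q1 = ennreal r1" "r2 < r1"
      using assms True r2 by (auto simp: ennreal_less_iff)
    then have "1 / q1 = ennreal (1 / r1)"
      by (simp add: divide_ennreal flip: ennreal_1)
    then have "1 / q3 = ennreal (1 / r2 - 1 / r1)"
      using assms(3) True inv2 r1 by (simp add: ennreal_minus)
    moreover have "0 < 1 / r2 - 1 / r1"
      using r1 r2 by (simp add: field_simps)
    ultimately show ?thesis
      using q3[of "1 / r2 - 1 / r1"] r1 r2 that(3)[of r1 r2 "1 / (1 / r2 - 1 / r1)"] by simp
  qed
qed

lemma lnorm_singleton [simp]: "0 < q \<Longrightarrow> lnorm q {k} a = a k"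
  by (cases rule: ennreal_exponent_cases, assumption)
     (auto simp: lnorm_top lnorm_ennreal nn_integral_count_space_finite epowr_epowr)

text \<open>A maximum replaces Young's inequality, which costs a factor 2 inside the root and works
  for all positive exponents, also below 1. For \<open>q2 = top\<close> the exponent
  \<open>1 / enn2real q2\<close> is 0 and the constant is 1.\<close>

lemma lnorm_Hoelder:
  assumes "0 < q1" "0 < q2" "1 / q3 = (if q1 > q2 then 1 / q2 - 1 / q1 else 0)"
    and u: "lnorm q3 S u \<le> 1" and v: "lnorm q1 S v \<le> 1"
  shows "lnorm q2 S (\<lambda>k. u k * v k) \<le> epowr 2 (1 / enn2real q2)"
proof -
  \<comment> \<open>Common end of the two regimes with \<open>q1 > q2\<close>: it suffices to
    dominate the powers of the products by two families of sum at most 1.\<close>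
  have uv: "lnorm (ennreal r2) S (\<lambda>k. u k * v k) \<le> epowr 2 (1 / r2)"
    if "\<And>k. k \<in> S \<Longrightarrow> epowr (u k * v k) r2 \<le> g k + h k" "0 < r2"
       "(\<integral>\<^sup>+k. g k \<partial>count_space S) \<le> 1" "(\<integral>\<^sup>+k. h k \<partial>count_space S) \<le> 1" for g h r2
  proof -
    have "(\<integral>\<^sup>+k. epowr (u k * v k) r2 \<partial>count_space S) \<le> (\<integral>\<^sup>+k. g k + h k \<partial>count_space S)"
      by (intro nn_integral_mono) (use that in auto)
    also have "\<dots> \<le> 2"
      using add_mono[OF that(3,4)] by (simp add: nn_integral_add)
    finally show ?thesis
      using that by (simp add: lnorm_ennreal_le_iff epowr_epowr)
  qed
  from assms(1-3) show ?thesis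
  proof (cases rule: dual_exponent_cases)
    case 1
    then have "u k \<le> 1" if "k \<in> S" for k
      using u that by (auto simp: lnorm_top SUP_le_iff)
    then have "lnorm q2 S (\<lambda>k. u k * v k) \<le> lnorm q2 S v"
      using assms mult_right_mono[of "u _" 1] by (intro lnorm_mono) fastforce+
    also have "\<dots> \<le> 1"
      using lnorm_exponent_mono[OF assms(1) _ v] 1 by auto
    also have "1 \<le> epowr 2 (1 / enn2real q2)"
      using epowr_mono[of "1 / enn2real q2" 1 2] by simp
    finally show ?thesis .
  next
    case (2 r)
    have "v k \<le> 1" if "k \<in> S" for k
      using v that 2 by (auto simp: lnorm_top SUP_le_iff)
    then have "epowr (u k * v k) r \<le> epowr (u k) r + 0" if "k \<in> S" for k
      using that 2 mult_left_mono[of "v k" 1 "u k"] by (auto intro!: epowr_mono)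
    from uv[OF this] show ?thesis
      using u 2 by (simp add: lnorm_ennreal_le_iff)
  next
    case (3 r1 r2 r3)
    have "epowr (u k * v k) r2 \<le> epowr (u k) r3 + epowr (v k) r1" for k
    proof -
      \<comment> \<open>Both factors are powers of quantities below \<open>m\<close>, with exponents
        \<open>1 / r3\<close> and \<open>1 / r1\<close> that add up to \<open>1 / r2\<close>; hence
        \<open>m\<close> itself bounds the \<open>r2\<close>-th power of the product.\<close>
      define m where "m = max (epowr (u k) r3) (epowr (v k) r1)"
      have "u k = epowr (epowr (u k) r3) (1 / r3)" using 3 by (simp add: epowr_epowr)
      also have "\<dots> \<le> epowr m (1 / r3)"
        using 3 by (intro epowr_mono) (auto simp: m_def)
      finally have uk: "u k \<le> epowr m (1 / r3)" .
      have "v k = epowr (epowr (v k) r1) (1 / r1)" using 3 by (simp add: epowr_epowr)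
      also have "\<dots> \<le> epowr m (1 / r1)"
        using 3 by (intro epowr_mono) (auto simp: m_def)
      finally have vk: "v k \<le> epowr m (1 / r1)" .
      have "u k * v k \<le> epowr m (1 / r3) * epowr m (1 / r1)"
        by (intro mult_mono uk vk) auto
      also have "\<dots> = epowr m (1 / r2)"
        using 3 by (simp add: epowr_add[symmetric])
      finally have "epowr (u k * v k) r2 \<le> epowr (epowr m (1 / r2)) r2"
        using 3 by (intro epowr_mono) auto
      also have "\<dots> = m" using 3(2) by (simp add: epowr_epowr)
      also have "m \<le> epowr (u k) r3 + epowr (v k) r1"
        by (auto simp: m_def)
      finally show ?thesis .
    qed
    from uv[OF this] show ?thesis
      using u v 3 by (simp add: lnorm_ennreal_le_iff)
  qed
qed

text \<open>The l^q quasi-norm of the sequence \<open>\<theta> ^ n\<close>,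
  \<open>n \<ge> 0\<close>.\<close>

definition geometric_const :: "ennreal \<Rightarrow> real \<Rightarrow> real" where
  "geometric_const q \<theta> = (if q = \<infinity> then 1 else (1 / (1 - \<theta> powr enn2real q)) powr (1 / enn2real q))"

lemma geometric_const_pos: "0 < q \<Longrightarrow> 0 < \<theta> \<Longrightarrow> \<theta> < 1 \<Longrightarrow> 0 < geometric_const q \<theta>"
  using powr_less_mono2[of "enn2real q" \<theta> 1]
  by (cases q) (auto simp: geometric_const_def)

text \<open>The \<open>r\<close>-th power of a supremum is at most the sum of the
  \<open>r\<close>-th powers, and the weights turn that sum into a geometric series. This avoids a
  quasi-triangle inequality and treats all exponents alike.\<close>

lemma lnorm_geometric_SUP_le:
  fixes w :: "nat \<Rightarrow> 'a \<Rightarrow> ennreal"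
  assumes "0 < q" "0 < \<theta>" "\<theta> < 1" and w: "\<And>n. lnorm q S (w n) \<le> B"
    and a: "\<And>k. k \<in> S \<Longrightarrow> a k \<le> (SUP n. ennreal (\<theta> ^ n) * w n k)"
  shows "lnorm q S a \<le> ennreal (geometric_const q \<theta>) * B"
  using assms(1)
proof (cases rule: ennreal_exponent_cases)
  case top
  have "a k \<le> B" if "k \<in> S" for k
  proof -
    have "ennreal (\<theta> ^ n) * w n k \<le> 1 * B" for n
      using assms that w[of n] top
      by (intro mult_mono) (auto simp: power_le_one lnorm_top SUP_le_iff)
    then have "(SUP n. ennreal (\<theta> ^ n) * w n k) \<le> B" by (intro SUP_least) auto
    with a[OF that] show ?thesis by (rule order_trans)
  qed
  then show ?thesis using top by (auto simp: lnorm_top geometric_const_def intro!: SUP_least)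
next
  case (real r)
  define \<rho> where "\<rho> = \<theta> powr r"
  have \<rho>: "0 < \<rho>" "\<rho> < 1"
    using assms real powr_less_mono2[of r \<theta> 1] by (auto simp: \<rho>_def)
  have pow: "(\<theta> ^ n) powr r = \<rho> ^ n" for n
    using assms(2) by (simp add: \<rho>_def powr_powr mult.commute flip: powr_realpow)
  have "epowr (a k) r \<le> (\<Sum>n. ennreal (\<rho> ^ n) * epowr (w n k) r)" if "k \<in> S" for k
  proof -
    let ?s = "\<Sum>n. ennreal (\<rho> ^ n) * epowr (w n k) r"
    have "ennreal (\<theta> ^ n) * w n k \<le> epowr ?s (1 / r)" for n
    proof -
      have "ennreal (\<theta> ^ n) * w n k = epowr (epowr (ennreal (\<theta> ^ n) * w n k) r) (1 / r)"
        using real by (simp add: epowr_epowr)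
      also have "epowr (ennreal (\<theta> ^ n) * w n k) r = ennreal (\<rho> ^ n) * epowr (w n k) r"
        using assms pow by (simp add: epowr_mult)
      also have "epowr \<dots> (1 / r) \<le> epowr ?s (1 / r)"
        using real sum_le_suminf[of "\<lambda>n. ennreal (\<rho> ^ n) * epowr (w n k) r" "{n}"]
        by (intro epowr_mono) auto
      finally show ?thesis .
    qed
    then have "(SUP n. ennreal (\<theta> ^ n) * w n k) \<le> epowr ?s (1 / r)"
      by (intro SUP_least) auto
    with a[OF that] have "a k \<le> epowr ?s (1 / r)" by (rule order_trans)
    then have "epowr (a k) r \<le> epowr (epowr ?s (1 / r)) r"
      using real by (intro epowr_mono) auto
    then show ?thesis using real by (simp add: epowr_epowr)
  qed
  then have "(\<integral>\<^sup>+k. epowr (a k) r \<partial>count_space S)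
      \<le> (\<integral>\<^sup>+k. (\<Sum>n. ennreal (\<rho> ^ n) * epowr (w n k) r) \<partial>count_space S)"
    by (intro nn_integral_mono) auto
  also have "\<dots> = (\<Sum>n. ennreal (\<rho> ^ n) * (\<integral>\<^sup>+k. epowr (w n k) r \<partial>count_space S))"
    by (simp add: nn_integral_suminf nn_integral_cmult)
  also have "\<dots> \<le> (\<Sum>n. ennreal (\<rho> ^ n) * epowr B r)"
    using w real by (intro suminf_le mult_left_mono) (auto simp: lnorm_ennreal_le_iff)
  also have "\<dots> = ennreal (1 / (1 - \<rho>)) * epowr B r"
    using \<rho> by (simp add: suminf_ennreal_eq[OF _ geometric_sums] suminf_geometric)
  also have "\<dots> = epowr (ennreal (geometric_const q \<theta>) * B) r"
    using \<rho> real by (simp add: epowr_mult geometric_const_def \<rho>_def powr_powr)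
  finally show ?thesis using real by (simp add: lnorm_ennreal_le_iff)
qed

text \<open>Converse of Hoelder by extremal sequences: unit vectors, the constant 1, or
  \<open>u k powr (r3 / r1)\<close> in the three regimes. Finiteness of \<open>F\<close> makes the
  sum \<open>t\<close> finite, so that a power of it can be cancelled.\<close>

lemma lnorm_dual:
  fixes u :: "'a \<Rightarrow> real"
  assumes "0 < q1" "0 < q2" "1 / q3 = (if q1 > q2 then 1 / q2 - 1 / q1 else 0)"
    and "finite F" "B < top" "\<And>k. k \<in> F \<Longrightarrow> 0 \<le> u k"
    and uv: "\<And>v :: 'a \<Rightarrow> real. (\<And>k. 0 \<le> v k) \<Longrightarrow>
      lnorm q2 F (\<lambda>k. ennreal (u k * v k)) \<le> B * lnorm q1 F (\<lambda>k. ennreal (v k))"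
  shows "lnorm q3 F (\<lambda>k. ennreal (u k)) \<le> B"
proof -
  from assms(1-3) show ?thesis
  proof (cases rule: dual_exponent_cases)
    case 1
    have "ennreal (u k) \<le> B" if k: "k \<in> F" for k
    proof -
      have "ennreal (u k) \<le> lnorm q2 F (\<lambda>j. ennreal (u j * indicator {k} j))"
        using lnorm_ge_point[OF assms(2) k, of "\<lambda>j. ennreal (u j * indicator {k} j)"] by simp
      also have "\<dots> \<le> B * lnorm q1 F (\<lambda>j. ennreal (indicator {k} j))"
        by (rule uv) simp
      also have "lnorm q1 F (\<lambda>j. ennreal (indicator {k} j)) \<le> lnorm q1 {k} (\<lambda>j. ennreal (indicator {k} j))"
        using assms k by (intro lnorm_le_zero_outside) auto
      also have "\<dots> = 1" using assms by simp
      finally show ?thesis by (simp add: mult_left_mono)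
    qed
    with 1 show ?thesis by (auto simp: lnorm_top intro!: SUP_least)
  next
    case (2 r)
    have "lnorm q2 F (\<lambda>k. ennreal (u k)) \<le> B * lnorm q1 F (\<lambda>k. ennreal 1)"
      using uv[of "\<lambda>k. 1"] by simp
    also have "lnorm q1 F (\<lambda>k. ennreal 1) \<le> 1"
      using 2 by (auto simp: lnorm_top intro!: SUP_least)
    finally show ?thesis using 2 by (simp add: mult_left_mono)
  next
    case (3 r1 r2 r3)
    define t where "t = (\<Sum>k\<in>F. u k powr r3)"
    have sum: "(\<Sum>k\<in>F. ennreal (u k powr r3)) = ennreal t"
      by (simp add: t_def sum_ennreal)
    have l3: "lnorm q3 F (\<lambda>k. ennreal (u k)) = epowr (ennreal t) (1 / r3)"
      using 3 assms(4,6) sum by (simp add: lnorm_ennreal nn_integral_count_space_finite)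
    have l1: "lnorm q1 F (\<lambda>k. ennreal (u k powr (r3 / r1))) = epowr (ennreal t) (1 / r1)"
      using 3 assms(4,6) sum by (simp add: lnorm_ennreal nn_integral_count_space_finite powr_powr)
    \<comment> \<open>Equality case of Hoelder: with this test sequence all three quasi-norms are
      powers of the same \<open>t\<close>.\<close>
    have exp: "(1 + r3 / r1) * r2 = r3" using 3 by (simp add: field_simps)
    have "(u k * u k powr (r3 / r1)) powr r2 = u k powr r3" if "k \<in> F" for k
      using assms(6)[OF that] exp by (simp add: powr_mult_base powr_powr)
    then have l2: "lnorm q2 F (\<lambda>k. ennreal (u k * u k powr (r3 / r1))) = epowr (ennreal t) (1 / r2)"
      using 3 assms(4,6) sum by (simp add: lnorm_ennreal nn_integral_count_space_finite)
    show ?thesis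
    proof (cases "t = 0")
      case True
      then show ?thesis by (simp add: l3)
    next
      case False
      have "0 \<le> t" by (auto simp: t_def intro: sum_nonneg)
      with False have t: "0 < t" by simp
      \<comment> \<open>The power \<open>1 / r2\<close> of \<open>t\<close> splits as
        \<open>1 / r3 + 1 / r1\<close>; the second part is the quasi-norm of the test sequence and
        cancels.\<close>
      have "epowr (ennreal t) (1 / r1) * epowr (ennreal t) (1 / r3) \<le> epowr (ennreal t) (1 / r1) * B"
        using uv[of "\<lambda>k. u k powr (r3 / r1)"] 3(7)
        unfolding l1 l2 by (simp add: epowr_add mult.commute)
      then show ?thesis using t by (simp add: l3 ennreal_mult_le_mult_iff)
    qed
  qed
qed

section \<open>The nonincreasing rearrangement\<close>

lemma L0_measurable: "x \<in> L0 I \<Longrightarrow> x \<in> borel_measurable (lebesgue_on I)"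
  by (simp add: L0_def)

lemma L0_sets:
  assumes "x \<in> L0 I" "Measurable.pred borel P"
  shows "{s \<in> I. P (x s)} \<in> sets (lebesgue_on I)"
proof -
  have "{s \<in> space (lebesgue_on I). P (x s)} \<in> sets (lebesgue_on I)"
    using assms(2) L0_measurable[OF assms(1)] by measurable
  then show ?thesis by simp
qed

lemma superlevel_sets:
  assumes "x \<in> L0 I"
  shows "{s \<in> I. c < \<bar>x s\<bar>} \<in> sets (lebesgue_on I)"
  using L0_sets[OF assms, of "\<lambda>v. c < \<bar>v\<bar>"] by simp

text \<open>The rearrangement is the generalized inverse of the distribution function. Restricting to finite
  \<open>c\<close> keeps \<open>\<infinity>\<close> out of the products below.\<close>

lemma rearrangement_le_iff:
  assumes x: "x \<in> L0 I" and "0 \<le> c"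
  shows "rearrangement I x t \<le> ennreal c \<longleftrightarrow> emeasure (lebesgue_on I) {s\<in>I. c < \<bar>x s\<bar>} \<le> ennreal t"
proof
  assume le: "emeasure (lebesgue_on I) {s\<in>I. c < \<bar>x s\<bar>} \<le> ennreal t"
  show "rearrangement I x t \<le> ennreal c"
  \<comment> \<open>The infimum ranges over strictly positive levels, so \<open>c\<close>, which may
    be 0, is approached from above.\<close>
  proof (rule ennreal_le_epsilon)
    fix e :: real assume "0 < e"
    then have "emeasure (lebesgue_on I) {s\<in>I. c + e < \<bar>x s\<bar>} \<le> emeasure (lebesgue_on I) {s\<in>I. c < \<bar>x s\<bar>}"
      by (intro emeasure_mono superlevel_sets[OF x]) auto
    with le have "emeasure (lebesgue_on I) {s\<in>I. c + e < \<bar>x s\<bar>} \<le> ennreal t" by (rule order_trans[rotated])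
    then have "rearrangement I x t \<le> ennreal (c + e)"
      unfolding rearrangement_def using \<open>0 < e\<close> assms by (intro Inf_lower imageI) auto
    then show "rearrangement I x t \<le> ennreal c + ennreal e"
      using \<open>0 < e\<close> assms by simp
  qed
next
  assume *: "rearrangement I x t \<le> ennreal c"
  \<comment> \<open>Conversely, each level \<open>c + \<epsilon> n\<close> lies above some
    admissible level of the infimum. The superlevel sets \<open>A n\<close> increase to the one at
    \<open>c\<close>, and continuity from below concludes.\<close>
  define \<epsilon> where "\<epsilon> n = inverse (real (Suc n))" for n
  have \<epsilon>: "0 < \<epsilon> n" "\<epsilon> (Suc n) \<le> \<epsilon> n" for n
    by (auto simp: \<epsilon>_def intro!: le_imp_inverse_le)
  define A where "A n = {s\<in>I. c + \<epsilon> n < \<bar>x s\<bar>}" for n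
  have "emeasure (lebesgue_on I) (A n) \<le> ennreal t" for n
  proof -
    have "rearrangement I x t < ennreal (c + \<epsilon> n)"
      using * by (rule le_less_trans) (use assms \<epsilon>(1)[of n] in \<open>subst ennreal_less_iff; simp\<close>)
    then obtain d where d: "0 < d" "emeasure (lebesgue_on I) {s\<in>I. d < \<bar>x s\<bar>} \<le> ennreal t"
        "ennreal d < ennreal (c + \<epsilon> n)"
      unfolding rearrangement_def Inf_less_iff by blast
    have "d < c + \<epsilon> n"
      using ennreal_less_iff[THEN iffD1, OF _ d(3)] d(1) by linarith
    then have "A n \<subseteq> {s\<in>I. d < \<bar>x s\<bar>}"
      unfolding A_def by (blast intro: less_trans)
    then have "emeasure (lebesgue_on I) (A n) \<le> emeasure (lebesgue_on I) {s\<in>I. d < \<bar>x s\<bar>}"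
      by (intro emeasure_mono superlevel_sets[OF x])
    also note d(2)
    finally show ?thesis .
  qed
  then have "(SUP n. emeasure (lebesgue_on I) (A n)) \<le> ennreal t"
    by (rule SUP_least)
  moreover have "(SUP n. emeasure (lebesgue_on I) (A n)) = emeasure (lebesgue_on I) (\<Union>n. A n)"
  proof (rule SUP_emeasure_incseq)
    show "range A \<subseteq> sets (lebesgue_on I)"
      unfolding A_def using superlevel_sets[OF x] by blast
    show "incseq A"
    proof (rule incseq_SucI)
      show "A n \<subseteq> A (Suc n)" for n
        using \<epsilon>(2)[of n] unfolding A_def by auto
    qed
  qed
  moreover have "(\<Union>n. A n) = {s\<in>I. c < \<bar>x s\<bar>}"
  proof (intro equalityI subsetI)
    fix s assume "s \<in> (\<Union>n. A n)"
    then obtain n where "s \<in> I" "c + \<epsilon> n < \<bar>x s\<bar>" unfolding A_def by blast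
    with \<epsilon>(1)[of n] show "s \<in> {s\<in>I. c < \<bar>x s\<bar>}" by simp
  next
    fix s assume s: "s \<in> {s\<in>I. c < \<bar>x s\<bar>}"
    then have "0 < \<bar>x s\<bar> - c" by simp
    from reals_Archimedean[OF this] obtain n where "\<epsilon> n < \<bar>x s\<bar> - c" unfolding \<epsilon>_def by blast
    with s show "s \<in> (\<Union>n. A n)" unfolding A_def by (auto simp: algebra_simps)
  qed
  ultimately show "emeasure (lebesgue_on I) {s\<in>I. c < \<bar>x s\<bar>} \<le> ennreal t"
    by simp
qed

lemma rearrangement_antimono: "s \<le> t \<Longrightarrow> rearrangement I x t \<le> rearrangement I x s"
  unfolding rearrangement_def
  using order_trans[OF _ ennreal_leI[of s t]] by (intro Inf_superset_mono image_mono) auto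

lemma emeasure_gt_if_less_rearrangement:
  assumes "x \<in> L0 I" "0 \<le> c" "ennreal c < rearrangement I x t"
  shows "ennreal t < emeasure (lebesgue_on I) {s\<in>I. c < \<bar>x s\<bar>}"
  using rearrangement_le_iff[OF assms(1,2), of t] assms(3) by (simp add: not_le[symmetric])

lemma emeasure_ge_if_less_rearrangement:
  assumes "x \<in> L0 I" "0 \<le> c" "ennreal c < rearrangement I x t"
  shows "ennreal t \<le> emeasure (lebesgue_on I) {s\<in>I. c \<le> \<bar>x s\<bar>}"
proof -
  have "ennreal t < emeasure (lebesgue_on I) {s\<in>I. c < \<bar>x s\<bar>}"
    by (rule emeasure_gt_if_less_rearrangement[OF assms])
  also have "\<dots> \<le> emeasure (lebesgue_on I) {s\<in>I. c \<le> \<bar>x s\<bar>}"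
    using L0_sets[OF assms(1), of "\<lambda>v. c \<le> \<bar>v\<bar>"] by (intro emeasure_mono) auto
  finally show ?thesis by simp
qed

text \<open>A rearrangement value \<open>d < c\<close> at \<open>t\<close> would put
  \<open>A\<close> inside the superlevel set at \<open>d\<close>, whose measure is at most
  \<open>t\<close>.\<close>

lemma rearrangement_ge:
  assumes x: "x \<in> L0 I" and A: "A \<in> sets (lebesgue_on I)" "ennreal t < emeasure (lebesgue_on I) A"
    and ge: "\<And>s. s \<in> A \<Longrightarrow> c \<le> \<bar>x s\<bar>"
  shows "ennreal c \<le> rearrangement I x t"
proof (rule ccontr)
  assume "\<not> ?thesis"
  then have less: "rearrangement I x t < ennreal c" by simp
  then obtain d where d: "0 \<le> d" "rearrangement I x t = ennreal d"
    by (cases "rearrangement I x t") auto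
  with less have "d < c" by (simp add: ennreal_less_iff)
  have "A \<subseteq> I" using sets.sets_into_space[OF A(1)] by simp
  have "emeasure (lebesgue_on I) A \<le> emeasure (lebesgue_on I) {s\<in>I. d < \<bar>x s\<bar>}"
    using superlevel_sets[OF x] less_le_trans[OF \<open>d < c\<close> ge] \<open>A \<subseteq> I\<close>
    by (intro emeasure_mono) auto
  also have "\<dots> \<le> ennreal t"
    using rearrangement_le_iff[OF x d(1), of t] d by simp
  finally show False using A(2) by simp
qed

lemma rearrangement_mono:
  assumes "x \<in> L0 I" "y \<in> L0 I" "AE s in lebesgue_on I. \<bar>x s\<bar> \<le> \<bar>y s\<bar>"
  shows "rearrangement I x t \<le> rearrangement I y t"
proof (cases "rearrangement I y t")
  case (real d)
  have "emeasure (lebesgue_on I) {s\<in>I. d < \<bar>x s\<bar>} \<le> emeasure (lebesgue_on I) {s\<in>I. d < \<bar>y s\<bar>}"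
    using assms(3) superlevel_sets[OF assms(2)]
    by (intro emeasure_mono_AE) auto
  also have "\<dots> \<le> ennreal t"
    using rearrangement_le_iff[OF assms(2) real(1), of t] real by simp
  finally show ?thesis
    using rearrangement_le_iff[OF assms(1) real(1), of t] real by simp
qed simp

lemma L0_mult: "x \<in> L0 I \<Longrightarrow> y \<in> L0 I \<Longrightarrow> (\<lambda>s. x s * y s) \<in> L0 I"
  unfolding L0_def by (rule borel_measurable_times)

lemma L0_cmult: "x \<in> L0 I \<Longrightarrow> (\<lambda>s. c * x s) \<in> L0 I"
  unfolding L0_def by (intro borel_measurable_times borel_measurable_const)

text \<open>A product above \<open>c * d\<close> needs one factor above its own threshold, so two
  superlevel sets of measure at most \<open>s\<close> and \<open>t\<close> cover that of the
  product. The finite rearrangement values serve as the real thresholds.\<close>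

lemma rearrangement_mult_le:
  assumes x: "x \<in> L0 I" and y: "y \<in> L0 I"
    and fin: "rearrangement I x s < top" "rearrangement I y t < top" and st: "0 \<le> s" "0 \<le> t"
  shows "rearrangement I (\<lambda>s. x s * y s) (s + t) \<le> rearrangement I x s * rearrangement I y t"
proof -
  obtain c d where c: "0 \<le> c" "rearrangement I x s = ennreal c"
      and d: "0 \<le> d" "rearrangement I y t = ennreal d"
    using fin by (cases "rearrangement I x s"; cases "rearrangement I y t") auto
  have sets: "{s\<in>I. c < \<bar>x s\<bar>} \<in> sets (lebesgue_on I)" "{s\<in>I. d < \<bar>y s\<bar>} \<in> sets (lebesgue_on I)"
    using superlevel_sets[OF x] superlevel_sets[OF y] by auto
  have "c < \<bar>x s\<bar> \<or> d < \<bar>y s\<bar>" if "c * d < \<bar>x s * y s\<bar>" for s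
  proof (rule ccontr)
    assume "\<not> ?thesis"
    then have "\<bar>x s\<bar> * \<bar>y s\<bar> \<le> c * d" using c(1) by (intro mult_mono) auto
    with that show False by (simp add: abs_mult)
  qed
  then have "{s\<in>I. c * d < \<bar>x s * y s\<bar>} \<subseteq> {s\<in>I. c < \<bar>x s\<bar>} \<union> {s\<in>I. d < \<bar>y s\<bar>}"
    by auto
  then have "emeasure (lebesgue_on I) {s\<in>I. c * d < \<bar>x s * y s\<bar>}
      \<le> emeasure (lebesgue_on I) ({s\<in>I. c < \<bar>x s\<bar>} \<union> {s\<in>I. d < \<bar>y s\<bar>})"
    using sets by (intro emeasure_mono) auto
  also have "\<dots> \<le> emeasure (lebesgue_on I) {s\<in>I. c < \<bar>x s\<bar>} + emeasure (lebesgue_on I) {s\<in>I. d < \<bar>y s\<bar>}"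
    using sets by (intro emeasure_subadditive)
  also have "\<dots> \<le> ennreal s + ennreal t"
    using rearrangement_le_iff[OF x c(1), of s] rearrangement_le_iff[OF y d(1), of t] c d
    by (intro add_mono) auto
  finally have "rearrangement I (\<lambda>s. x s * y s) (s + t) \<le> ennreal (c * d)"
    using rearrangement_le_iff[OF L0_mult[OF x y], of "c * d" "s + t"] c d st by simp
  then show ?thesis using c d by (simp add: ennreal_mult)
qed

lemma rearrangement_cmult:
  assumes x: "x \<in> L0 I" and "0 < a"
  shows "rearrangement I (\<lambda>s. a * x s) t = ennreal a * rearrangement I x t"
proof -
  \<comment> \<open>One inequality for all positive factors is enough: the other follows by applying
    it with \<open>1 / a\<close> to the function \<open>a * x\<close>.\<close>
  have le: "rearrangement I (\<lambda>s. b * y s) t \<le> ennreal b * rearrangement I y t"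
    if y: "y \<in> L0 I" and "0 < b" for b y
  proof (cases "rearrangement I y t")
    case (real d)
    have "{s\<in>I. b * d < \<bar>b * y s\<bar>} = {s\<in>I. d < \<bar>y s\<bar>}"
      using \<open>0 < b\<close> by (simp add: abs_mult mult_less_cancel_left_pos)
    then have "rearrangement I (\<lambda>s. b * y s) t \<le> ennreal (b * d)"
      using rearrangement_le_iff[OF L0_cmult[OF y], of "b * d" b t]
        rearrangement_le_iff[OF y real(1), of t] real that by simp
    then show ?thesis using real that by (simp add: ennreal_mult)
  qed (use that in \<open>simp add: ennreal_mult_top\<close>)
  have "rearrangement I x t \<le> ennreal (1 / a) * rearrangement I (\<lambda>s. a * x s) t"
    using le[OF L0_cmult[OF x, of a], of "1 / a"] assms by simp
  then have "ennreal a * rearrangement I x t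
      \<le> ennreal a * (ennreal (1 / a) * rearrangement I (\<lambda>s. a * x s) t)"
    by (rule mult_left_mono) simp
  also have "\<dots> = rearrangement I (\<lambda>s. a * x s) t"
    using assms by (simp add: mult.assoc[symmetric] ennreal_mult[symmetric])
  finally show ?thesis using le[OF x] assms by (intro antisym) auto
qed

lemma rearrangement_AE_zero:
  assumes "AE s in lebesgue_on I. x s = 0" "x \<in> L0 I"
  shows "rearrangement I x t = 0"
proof -
  have "emeasure (lebesgue_on I) {s\<in>I. 0 < \<bar>x s\<bar>} \<le> ennreal t"
    using AE_iff_null[of "lebesgue_on I" "\<lambda>s. x s = 0"] assms(1)
      L0_sets[OF assms(2), of "\<lambda>v. v \<noteq> 0"] by (simp add: null_setsD1)
  then show ?thesis
    using rearrangement_le_iff[OF assms(2), of 0 t] by simp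
qed

text \<open>The negated indicator of such a set is monotone, hence Borel. This yields measurability
  of rearrangements, whose strict superlevel sets are down-closed.\<close>

lemma sets_borel_down_closed:
  fixes D :: "real set"
  assumes "\<And>s t. t \<in> D \<Longrightarrow> s \<le> t \<Longrightarrow> s \<in> D"
  shows "D \<in> sets borel"
proof -
  have "(\<lambda>t. - indicator D t :: real) \<in> borel_measurable borel"
    using assms by (intro borel_measurable_mono) (auto simp: mono_def split: split_indicator)
  then have "(\<lambda>t. indicator D t :: real) \<in> borel_measurable borel"
    by simp
  then show ?thesis by (simp add: borel_measurable_indicator_iff)
qed

lemma rearrangement_measurable [measurable]: "rearrangement I x \<in> borel_measurable borel"
proof (rule borel_measurableI_greater)
  show "{t \<in> space borel. a < rearrangement I x t} \<in> sets borel" for a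
    using less_le_trans[OF _ rearrangement_antimono] by (intro sets_borel_down_closed) auto
qed

section \<open>Dyadic discretization of the Lorentz quasi-norm\<close>

text \<open>All integers for the half-line, the negative ones for the unit interval. Strictness
  keeps \<open>2 powr k\<close> in the range of \<open>t\<close> used by the Lorentz
  quasi-norm.\<close>

definition dyadic_indices :: "real set \<Rightarrow> int set" where
  "dyadic_indices I = {k. ennreal (2 powr real_of_int k) < emeasure lebesgue I}"

text \<open>The parameter \<open>e\<close> stands for \<open>1 / p\<close>, so an infinite
  \<open>p\<close> is simply \<open>e = 0\<close>.\<close>

definition dyadic_norm :: "real set \<Rightarrow> real \<Rightarrow> ennreal \<Rightarrow> (real \<Rightarrow> real) \<Rightarrow> ennreal" where
  "dyadic_norm I e q x = lnorm q (dyadic_indices I)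
     (\<lambda>k. ennreal (2 powr (e * real_of_int k)) * rearrangement I x (2 powr real_of_int k))"

lemma dyadic_indices_antimono: "k \<in> dyadic_indices I \<Longrightarrow> j \<le> k \<Longrightarrow> j \<in> dyadic_indices I"
  using le_less_trans[OF ennreal_leI, of "2 powr real_of_int j" "2 powr real_of_int k"]
  by (simp add: dyadic_indices_def)

lemma dyadic_floor:
  assumes "0 < t"
  obtains k :: int where "2 powr real_of_int k \<le> t" "t < 2 powr (real_of_int k + 1)"
proof (rule that)
  show "2 powr real_of_int \<lfloor>log 2 t\<rfloor> \<le> t"
    using assms by (intro le_log_iff[THEN iffD1]) auto
  show "t < 2 powr (real_of_int \<lfloor>log 2 t\<rfloor> + 1)"
    using assms by (intro log_less_iff[THEN iffD1]) (auto simp: floor_less_iff)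
qed

lemma nn_integral_count_space_disjoint_indicator:
  assumes "k \<in> S" "t \<in> A k" "\<And>j. j \<in> S \<Longrightarrow> t \<in> A j \<Longrightarrow> j = k"
  shows "(\<integral>\<^sup>+j. f j * indicator (A j) t \<partial>count_space S) = f k"
proof -
  have "(\<integral>\<^sup>+j. f j * indicator (A j) t \<partial>count_space S) = (\<Sum>j\<in>{k}. f j * indicator (A j) t)"
  proof (intro nn_integral_count_space')
    show "f j * indicator (A j) t = 0" if "j \<in> S" "j \<notin> {k}" for j
      using assms(3)[OF that(1)] that(2) by (cases "t \<in> A j") auto
  qed (use assms(1) in auto)
  then show ?thesis using assms(2) by simp
qed

lemma lorentz_integrand_measurable:
  "(\<lambda>t. epowr (ennreal (t powr e) * rearrangement I x t) r / ennreal t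
     * indicator {t. 0 < t \<and> ennreal t < c} t) \<in> borel_measurable borel"
proof (intro borel_measurable_times_ennreal borel_measurable_divide_ennreal borel_measurable_epowr
    borel_measurable_indicator rearrangement_measurable)
  show "(\<lambda>t. ennreal (t powr e)) \<in> borel_measurable borel" "ennreal \<in> borel_measurable borel"
    by measurable
  have "{t \<in> space borel. 0 < t \<and> ennreal t < c} \<in> sets borel"
    by measurable
  then show "{t. 0 < t \<and> ennreal t < c} \<in> sets borel"
    by simp
qed

text \<open>Lebesgue measure is the completion of \<open>lborel\<close>; on the latter the integrand
  is measurable and sums and integrals can be exchanged.\<close>

lemma lorentz_norm_eq_lborel:
  assumes "0 < r"
  shows "lorentz_norm I p (ennreal r) x = epowr (\<integral>\<^sup>+t.
      epowr (ennreal (t powr enn2real (1 / p)) * rearrangement I x t) r / ennreal t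
        * indicator {t. 0 < t \<and> ennreal t < emeasure lebesgue I} t \<partial>lborel) (1 / r)"
  using assms unfolding lorentz_norm_def Let_def nn_integral_completion by simp

text \<open>On \<open>[2^k, 2^(k+1))\<close> the rearrangement is at most its value at the left end
  and \<open>t powr e\<close> is at most \<open>2 powr e\<close> times its value there. Since
  \<open>1 / t \<le> 2^(-k)\<close> on a block of length \<open>2^k\<close>, its mass for dt/t is at
  most 1.\<close>

lemma lorentz_norm_le_dyadic_norm:
  assumes "0 < q"
  shows "lorentz_norm I p q x
    \<le> ennreal (2 powr enn2real (1 / p)) * dyadic_norm I (enn2real (1 / p)) q x"
proof -
  define e where "e = enn2real (1 / p)"
  have e: "0 \<le> e" by (simp add: e_def)
  define J where "J = {t. 0 < t \<and> ennreal t < emeasure lebesgue I}"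
  define d where "d k = ennreal (2 powr e) *
     (ennreal (2 powr (e * real_of_int k)) * rearrangement I x (2 powr real_of_int k))" for k :: int
  have D: "ennreal (2 powr e) * dyadic_norm I e q x = lnorm q (dyadic_indices I) d"
    unfolding dyadic_norm_def d_def using assms by (simp add: lnorm_cmult)
  have le: "ennreal (t powr e) * rearrangement I x t \<le> d k"
    if "2 powr real_of_int k \<le> t" "t < 2 powr (real_of_int k + 1)" for t k
  proof -
    have "0 < t" using that(1) by (rule less_le_trans[rotated]) simp
    have "t powr e \<le> (2 powr (real_of_int k + 1)) powr e"
      using that e \<open>0 < t\<close> by (intro powr_mono2) auto
    also have "\<dots> = 2 powr e * 2 powr (e * real_of_int k)"
      by (simp add: powr_powr algebra_simps flip: powr_add)
    finally have "ennreal (t powr e) \<le> ennreal (2 powr e) * ennreal (2 powr (e * real_of_int k))"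
      by (simp add: ennreal_leI flip: ennreal_mult)
    then show ?thesis
      unfolding d_def mult.assoc[symmetric]
      using that by (intro mult_mono rearrangement_antimono) auto
  qed
  have ind: "k \<in> dyadic_indices I" if "t \<in> J" "2 powr real_of_int k \<le> t" for t k
    using that le_less_trans[OF ennreal_leI[OF that(2)]] by (auto simp: J_def dyadic_indices_def)
  from assms show ?thesis
  proof (cases rule: ennreal_exponent_cases)
    case top
    have "(SUP t\<in>J. ennreal (t powr e) * rearrangement I x t) \<le> (SUP k\<in>dyadic_indices I. d k)"
    proof (rule SUP_least)
      fix t assume t: "t \<in> J"
      then have "0 < t" by (simp add: J_def)
      from dyadic_floor[OF this] obtain k :: int where k: "2 powr real_of_int k \<le> t" "t < 2 powr (real_of_int k + 1)" .
      show "ennreal (t powr e) * rearrangement I x t \<le> (SUP k\<in>dyadic_indices I. d k)"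
        using le[OF k] ind[OF t k(1)] by (rule SUP_upper2[rotated])
    qed
    then show ?thesis
      using top D by (simp add: lorentz_norm_def e_def J_def lnorm_top)
  next
    case (real r)
    define A where "A k = {2 powr real_of_int k ..< 2 powr (real_of_int k + 1)}" for k :: int
    have sA: "A k \<in> sets borel" for k by (simp add: A_def)
    have mA: "emeasure lborel (A k) = ennreal (2 powr real_of_int k)" for k
      by (simp add: A_def powr_add)
    have "(\<integral>\<^sup>+t. epowr (ennreal (t powr e) * rearrangement I x t) r / ennreal t * indicator J t \<partial>lborel)
        \<le> (\<integral>\<^sup>+t. (\<integral>\<^sup>+k. epowr (d k) r * ennreal (2 powr - real_of_int k) * indicator (A k) t
            \<partial>count_space (dyadic_indices I)) \<partial>lborel)"
    proof (rule nn_integral_mono)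
      fix t :: real
      show "epowr (ennreal (t powr e) * rearrangement I x t) r / ennreal t * indicator J t
        \<le> (\<integral>\<^sup>+k. epowr (d k) r * ennreal (2 powr - real_of_int k) * indicator (A k) t
            \<partial>count_space (dyadic_indices I))"
      proof (cases "t \<in> J")
        case True
        then have "0 < t" by (simp add: J_def)
        from dyadic_floor[OF this] obtain k :: int where k: "2 powr real_of_int k \<le> t" "t < 2 powr (real_of_int k + 1)" .
        have "inverse t \<le> inverse (2 powr real_of_int k)"
          using k by (intro le_imp_inverse_le) auto
        then have "inverse (ennreal t) \<le> ennreal (2 powr - real_of_int k)"
          using \<open>0 < t\<close> by (simp add: inverse_ennreal powr_minus ennreal_leI)
        then have "epowr (ennreal (t powr e) * rearrangement I x t) r * inverse (ennreal t) * indicator J t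
          \<le> epowr (d k) r * ennreal (2 powr - real_of_int k) * indicator (A k) t"
          using le[OF k] real True k by (auto intro!: mult_mono epowr_mono simp: A_def)
        also have "\<dots> \<le> (\<integral>\<^sup>+k. epowr (d k) r * ennreal (2 powr - real_of_int k) * indicator (A k) t
            \<partial>count_space (dyadic_indices I))"
          using ind[OF True k(1)] by (rule nn_integral_ge_point)
        finally show ?thesis by (simp add: divide_ennreal_def)
      qed simp
    qed
    also have "\<dots> = (\<integral>\<^sup>+k. (\<integral>\<^sup>+t. epowr (d k) r * ennreal (2 powr - real_of_int k) * indicator (A k) t
        \<partial>lborel) \<partial>count_space (dyadic_indices I))"
      by (intro nn_integral_count_space_nn_integral) (auto simp: A_def)
    also have "\<dots> = (\<integral>\<^sup>+k. epowr (d k) r \<partial>count_space (dyadic_indices I))"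
    proof (intro nn_integral_cong)
      fix k
      have "(\<integral>\<^sup>+t. epowr (d k) r * ennreal (2 powr - real_of_int k) * indicator (A k) t \<partial>lborel)
        = epowr (d k) r * ennreal (2 powr - real_of_int k) * ennreal (2 powr real_of_int k)"
        by (subst nn_integral_cmult_indicator) (auto simp: sA mA)
      then show "(\<integral>\<^sup>+t. epowr (d k) r * ennreal (2 powr - real_of_int k) * indicator (A k) t \<partial>lborel)
        = epowr (d k) r"
        by (simp add: mult.assoc ennreal_mult[symmetric] powr_minus)
    qed
    finally have "lorentz_norm I p q x \<le> lnorm q (dyadic_indices I) d"
      using real by (simp add: lnorm_ennreal lorentz_norm_eq_lborel[OF real(1)] epowr_mono J_def e_def)
    then show ?thesis using D by (simp add: e_def)
  qed
qed

text \<open>On \<open>(2^(k-1), 2^k]\<close> the rearrangement is at least its value at the right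
  end and \<open>t powr e\<close> is smaller by at most \<open>2 powr e\<close>. The mass for dt/t
  is at least 1/2, and the \<open>q\<close>-th root of this half is compensated by
  \<open>c\<close>.\<close>

lemma dyadic_norm_le_lorentz_norm:
  assumes "0 < q"
  defines "c \<equiv> (if q = top then 1 else 2 powr (1 / enn2real q))"
  shows "dyadic_norm I (enn2real (1 / p)) q x
    \<le> ennreal (c * 2 powr enn2real (1 / p)) * lorentz_norm I p q x"
proof -
  define e where "e = enn2real (1 / p)"
  have e: "0 \<le> e" by (simp add: e_def)
  define J where "J = {t. 0 < t \<and> ennreal t < emeasure lebesgue I}"
  define d where "d k = ennreal (2 powr - e) *
     (ennreal (2 powr (e * real_of_int k)) * rearrangement I x (2 powr real_of_int k))" for k :: int
  have "ennreal (2 powr - e) * dyadic_norm I e q x = lnorm q (dyadic_indices I) d"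
    unfolding dyadic_norm_def d_def using assms by (simp add: lnorm_cmult)
  then have "ennreal (2 powr e) * ennreal (2 powr - e) * dyadic_norm I e q x
      = ennreal (2 powr e) * lnorm q (dyadic_indices I) d"
    by (simp add: mult.assoc)
  then have D: "dyadic_norm I e q x = ennreal (2 powr e) * lnorm q (dyadic_indices I) d"
    by (simp add: powr_minus flip: ennreal_mult)
  have le: "d k \<le> ennreal (t powr e) * rearrangement I x t"
    if "2 powr (real_of_int k - 1) < t" "t \<le> 2 powr real_of_int k" for t k
  proof -
    have "2 powr - e * 2 powr (e * real_of_int k) = (2 powr (real_of_int k - 1)) powr e"
      by (simp add: powr_powr algebra_simps flip: powr_add)
    also have "\<dots> \<le> t powr e"
      using that e by (intro powr_mono2) auto
    finally have "ennreal (2 powr - e) * ennreal (2 powr (e * real_of_int k)) \<le> ennreal (t powr e)"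
      by (simp add: ennreal_leI flip: ennreal_mult)
    then show ?thesis
      unfolding d_def mult.assoc[symmetric]
      using that by (intro mult_mono rearrangement_antimono) auto
  qed
  have ind: "t \<in> J" if "k \<in> dyadic_indices I" "2 powr (real_of_int k - 1) < t" "t \<le> 2 powr real_of_int k" for t k
    using that le_less_trans[OF ennreal_leI[OF that(3)]] less_trans[OF _ that(2), of 0]
    by (auto simp: J_def dyadic_indices_def)
  have "lnorm q (dyadic_indices I) d \<le> ennreal c * lorentz_norm I p q x"
    using assms(1)
  proof (cases rule: ennreal_exponent_cases)
    case top
    have "(SUP k\<in>dyadic_indices I. d k) \<le> (SUP t\<in>J. ennreal (t powr e) * rearrangement I x t)"
    proof (rule SUP_mono)
      fix k assume k: "k \<in> dyadic_indices I"
      have "2 powr (real_of_int k - 1) < 2 powr real_of_int k" by simp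
      with k show "\<exists>t\<in>J. d k \<le> ennreal (t powr e) * rearrangement I x t"
        using ind[of k "2 powr real_of_int k"] le[of k "2 powr real_of_int k"] by auto
    qed
    then show ?thesis
      using top by (simp add: lorentz_norm_def e_def J_def lnorm_top c_def)
  next
    case (real r)
    \<comment> \<open>Blocks lie to the left of \<open>2^k\<close>, because membership of
      \<open>k\<close> in the index set only says that \<open>2^k\<close> is below the measure of
      \<open>I\<close>.\<close>
    define A where "A k = {2 powr (real_of_int k - 1) <.. 2 powr real_of_int k}" for k :: int
    have sA: "A k \<in> sets borel" for k by (simp add: A_def)
    have mA: "emeasure lborel (A k) = ennreal (2 powr real_of_int k / 2)" for k
      by (simp add: A_def powr_diff)
    \<comment> \<open>The estimate runs from the sum over blocks to the integral, so at each
      \<open>t\<close> at most one block may contribute.\<close>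
    have uniq: "j = k" if "t \<in> A j" "t \<in> A k" for j k t
    proof -
      have "2 powr (real_of_int j - 1) < 2 powr real_of_int k" "2 powr (real_of_int k - 1) < 2 powr real_of_int j"
        using that less_le_trans[of "2 powr (real_of_int j - 1)" t] less_le_trans[of "2 powr (real_of_int k - 1)" t]
        unfolding A_def by (simp_all del: powr_less_cancel_iff)
      then show ?thesis by simp
    qed
    have "ennreal (1 / 2) * (\<integral>\<^sup>+k. epowr (d k) r \<partial>count_space (dyadic_indices I))
      = (\<integral>\<^sup>+k. (\<integral>\<^sup>+t. epowr (d k) r * ennreal (2 powr - real_of_int k) * indicator (A k) t
        \<partial>lborel) \<partial>count_space (dyadic_indices I))"
    proof (subst nn_integral_cmult[symmetric], simp, intro nn_integral_cong)
      fix k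
      have "(\<integral>\<^sup>+t. epowr (d k) r * ennreal (2 powr - real_of_int k) * indicator (A k) t \<partial>lborel)
        = epowr (d k) r * ennreal (2 powr - real_of_int k) * ennreal (2 powr real_of_int k / 2)"
        by (subst nn_integral_cmult_indicator) (auto simp: sA mA)
      also have "\<dots> = ennreal (1 / 2) * epowr (d k) r"
      proof -
        have "ennreal (2 powr - real_of_int k) * ennreal (2 powr real_of_int k / 2) = ennreal (1 / 2)"
          by (simp add: powr_minus ennreal_mult[symmetric] del: ennreal_half)
        then show ?thesis
          unfolding mult.assoc by (simp only: mult.commute)
      qed
      finally show "ennreal (1 / 2) * epowr (d k) r
        = (\<integral>\<^sup>+t. epowr (d k) r * ennreal (2 powr - real_of_int k) * indicator (A k) t \<partial>lborel)"
        by simp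
    qed
    also have "\<dots> = (\<integral>\<^sup>+t. (\<integral>\<^sup>+k. epowr (d k) r * ennreal (2 powr - real_of_int k) * indicator (A k) t
            \<partial>count_space (dyadic_indices I)) \<partial>lborel)"
      by (intro nn_integral_count_space_nn_integral[symmetric]) (auto simp: A_def)
    also have "\<dots> \<le> (\<integral>\<^sup>+t. epowr (ennreal (t powr e) * rearrangement I x t) r / ennreal t * indicator J t \<partial>lborel)"
    proof (rule nn_integral_mono)
      fix t :: real
      show "(\<integral>\<^sup>+k. epowr (d k) r * ennreal (2 powr - real_of_int k) * indicator (A k) t
            \<partial>count_space (dyadic_indices I))
          \<le> epowr (ennreal (t powr e) * rearrangement I x t) r / ennreal t * indicator J t"
      proof (cases "\<exists>k\<in>dyadic_indices I. t \<in> A k")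
        case True
        then obtain k where k: "k \<in> dyadic_indices I" "t \<in> A k" by blast
        then have "2 powr (real_of_int k - 1) < t" and t: "t \<le> 2 powr real_of_int k"
          by (auto simp: A_def)
        then have "0 < t" using less_trans[of 0 "2 powr (real_of_int k - 1)" t] by simp
        have "inverse (2 powr real_of_int k) \<le> inverse t"
          using t \<open>0 < t\<close> by (intro le_imp_inverse_le) auto
        then have "ennreal (2 powr - real_of_int k) \<le> inverse (ennreal t)"
          using \<open>0 < t\<close> by (simp add: inverse_ennreal powr_minus ennreal_leI)
        moreover have "epowr (d k) r \<le> epowr (ennreal (t powr e) * rearrangement I x t) r"
          using real le k by (intro epowr_mono) (auto simp: A_def)
        moreover have "t \<in> J" using ind k by (auto simp: A_def)
        ultimately show ?thesis
          using nn_integral_count_space_disjoint_indicator[where A = A and t = t, OF k, of "\<lambda>k. epowr (d k) r * ennreal (2 powr - real_of_int k)"]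
            uniq[OF _ k(2)] 
            by (simp add: divide_ennreal_def mult_mono)
      next
        case False
        then have "(\<integral>\<^sup>+k. epowr (d k) r * ennreal (2 powr - real_of_int k) * indicator (A k) t
            \<partial>count_space (dyadic_indices I)) = (\<integral>\<^sup>+k. 0 \<partial>count_space (dyadic_indices I))"
          by (intro nn_integral_cong) auto
        then show ?thesis by simp
      qed
    qed
    finally have *: "epowr (ennreal (1 / 2) * (\<integral>\<^sup>+k. epowr (d k) r \<partial>count_space (dyadic_indices I))) (1 / r)
        \<le> lorentz_norm I p q x"
      using real by (simp add: lorentz_norm_eq_lborel[OF real(1)] epowr_mono J_def e_def)
    have "ennreal (2 powr (1 / r)) * epowr (ennreal (1 / 2)) (1 / r) = 1"
      by (simp del: ennreal_half add: powr_divide flip: ennreal_mult)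
    then have "lnorm q (dyadic_indices I) d
       = ennreal c * epowr (ennreal (1 / 2) * (\<integral>\<^sup>+k. epowr (d k) r \<partial>count_space (dyadic_indices I))) (1 / r)"
      using real by (simp del: ennreal_half add: lnorm_ennreal epowr_mult c_def mult.assoc[symmetric])
    also have "\<dots> \<le> ennreal c * lorentz_norm I p q x"
      using * by (rule mult_left_mono) simp
    finally show ?thesis .
  qed
  then have "dyadic_norm I e q x \<le> ennreal (2 powr e) * (ennreal c * lorentz_norm I p q x)"
    unfolding D by (rule mult_left_mono) simp
  then show ?thesis
    by (simp add: e_def c_def ennreal_mult mult_ac)
qed

section \<open>Step functions on disjoint dyadic blocks\<close>

text \<open>The measure of the part of \<open>B\<close> in \<open>[-s, s]\<close> is Lipschitz in
  \<open>s\<close> with constant 2, starts at 0 and tends to the measure of \<open>B\<close>; the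
  intermediate value theorem gives \<open>m\<close>.\<close>

lemma lebesgue_subset_with_measure:
  fixes B :: "real set"
  assumes B: "B \<in> sets lebesgue" and "0 \<le> m" "ennreal m \<le> emeasure lebesgue B"
  shows "\<exists>A\<in>sets lebesgue. A \<subseteq> B \<and> emeasure lebesgue A = ennreal m"
\<comment> \<open>The full measure may be reached only in the limit of large \<open>s\<close>; in
  that case \<open>B\<close> itself is the witness.\<close>
proof (cases "emeasure lebesgue B = ennreal m")
  case False
  with assms have less: "ennreal m < emeasure lebesgue B" by simp
  define C where "C s = B \<inter> {-s..s}" for s :: real
  have C: "C s \<in> lmeasurable" for s
    unfolding C_def using fmeasurable_Int_fmeasurable[OF lmeasurable_interval(1) B, of "-s" s]
    by (simp add: Int_commute)
  define f where "f s = measure lebesgue (C s)" for s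
  have f: "emeasure lebesgue (C s) = ennreal (f s)" for s
    unfolding f_def using C by (simp add: emeasure_eq_measure2)
  have step: "\<bar>f t - f s\<bar> \<le> 2 * \<bar>t - s\<bar>" if "0 \<le> s" "s \<le> t" for s t
  proof -
    have "f s \<le> f t"
      unfolding f_def using that C by (intro measure_mono_fmeasurable) (auto simp: C_def fmeasurableD)
    have "f t \<le> measure lebesgue (C s \<union> ({-t..-s} \<union> {s..t}))"
      unfolding f_def using that C by (intro measure_mono_fmeasurable fmeasurable.Un) (auto simp: C_def fmeasurableD)
    also have "\<dots> \<le> measure lebesgue (C s) + (measure lebesgue {-t..-s} + measure lebesgue {s..t})"
      using C by (intro measure_Un_le[THEN order_trans] add_left_mono measure_Un_le) (auto simp: fmeasurableD)
    also have "\<dots> = f s + 2 * (t - s)"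
      using that by (simp add: f_def)
    finally show ?thesis using \<open>f s \<le> f t\<close> that by simp
  qed
  have cont: "continuous_on {0..n} f" for n
  proof (rule lipschitz_on_continuous_on)
    show "2-lipschitz_on {0..n} f"
    proof (rule lipschitz_onI)
      fix s t assume "s \<in> {0..n}" "t \<in> {0..n}"
      then show "dist (f s) (f t) \<le> 2 * dist s t"
        using step[of s t] step[of t s] by (cases "s \<le> t") (auto simp: dist_real_def abs_minus_commute)
    qed simp
  qed
  have "(SUP n. emeasure lebesgue (C (real n))) = emeasure lebesgue (\<Union>n. C (real n))"
    using C by (intro SUP_emeasure_incseq) (auto simp: incseq_def C_def fmeasurableD)
  also have "(\<Union>n. C (real n)) = B"
  proof -
    have "\<exists>n. - real n \<le> s \<and> s \<le> real n" for s
      using real_arch_simple[of "\<bar>s\<bar>"] by (auto simp: abs_le_iff) (metis minus_le_iff)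
    then show ?thesis by (auto simp: C_def)
  qed
  finally have "ennreal m < (SUP n. emeasure lebesgue (C (real n)))"
    using less by simp
  then obtain n where n: "ennreal m < ennreal (f (real n))"
    unfolding f less_SUP_iff by blast
  have "f 0 = 0"
  proof -
    have "emeasure lebesgue (C 0) \<le> emeasure lebesgue {0::real}"
      by (intro emeasure_mono) (auto simp: C_def)
    then show ?thesis by (simp add: f_def measure_def)
  qed
  moreover have "m \<le> f (real n)"
    using n by (simp add: ennreal_less_iff assms)
  ultimately obtain s where "f s = m"
    using IVT'[of f 0 m "real n"] cont assms by auto
  then show ?thesis
    using f C by (intro bexI[of _ "C s"]) (auto simp: C_def fmeasurableD)
qed (use B in auto)

lemma sum_powr_2_le:
  assumes "finite F" "\<And>k. k \<in> F \<Longrightarrow> k \<le> b"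
  shows "(\<Sum>k\<in>F. 2 powr (real_of_int k - 1)) \<le> 2 powr real_of_int b"
  using assms
proof (induction F arbitrary: b rule: finite_linorder_max_induct)
  case (insert m F)
  have "(\<Sum>k\<in>F. 2 powr (real_of_int k - 1)) \<le> 2 powr (real_of_int m - 1)"
    using insert.IH[of "m - 1"] insert.hyps by auto
  moreover have "m \<notin> F" using insert by auto
  then have "(\<Sum>k\<in>insert m F. 2 powr (real_of_int k - 1))
      = 2 powr (real_of_int m - 1) + (\<Sum>k\<in>F. 2 powr (real_of_int k - 1))"
    using insert.hyps(1) by (intro sum.insert)
  moreover have "2 powr (real_of_int m - 1) + 2 powr (real_of_int m - 1) = 2 powr real_of_int m"
    by (simp add: powr_diff)
  moreover have "2 powr real_of_int m \<le> 2 powr real_of_int b"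
    using insert.prems[of m] by (intro powr_mono) auto
  ultimately show ?case by linarith
qed simp

text \<open>Greedy choice in increasing order of \<open>k\<close>: the sets chosen before index
  \<open>b\<close> have total measure at most \<open>2^(b-1)\<close>, which leaves at least that
  much of \<open>B b\<close>. Halving the measures is what makes room.\<close>

lemma disjoint_dyadic_subsets:
  fixes B :: "int \<Rightarrow> real set"
  assumes "finite F"
    and "\<And>k. k \<in> F \<Longrightarrow> B k \<in> sets lebesgue"
    and "\<And>k. k \<in> F \<Longrightarrow> ennreal (2 powr real_of_int k) \<le> emeasure lebesgue (B k)"
  shows "\<exists>A. disjoint_family_on A F \<and> (\<forall>k\<in>F. A k \<in> sets lebesgue \<and> A k \<subseteq> B k
      \<and> emeasure lebesgue (A k) = ennreal (2 powr (real_of_int k - 1)))"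
  using assms
proof (induction F rule: finite_linorder_max_induct)
  case (insert b F)
  then obtain A where A: "disjoint_family_on A F" "\<And>k. k \<in> F \<Longrightarrow> A k \<in> sets lebesgue"
    "\<And>k. k \<in> F \<Longrightarrow> A k \<subseteq> B k" "\<And>k. k \<in> F \<Longrightarrow> emeasure lebesgue (A k) = ennreal (2 powr (real_of_int k - 1))"
    by (metis insertCI)
  have "b \<notin> F" using insert by auto
  define U where "U = (\<Union>k\<in>F. A k)"
  have U: "U \<in> sets lebesgue" unfolding U_def using A insert by auto
  have "emeasure lebesgue U \<le> (\<Sum>k\<in>F. emeasure lebesgue (A k))"
    unfolding U_def using A insert by (intro emeasure_subadditive_finite) auto
  also have "\<dots> = ennreal (\<Sum>k\<in>F. 2 powr (real_of_int k - 1))"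
    using A by (simp add: sum_ennreal)
  also have "\<dots> \<le> ennreal (2 powr real_of_int (b - 1))"
    using insert by (intro ennreal_leI sum_powr_2_le) auto
  finally have mU: "emeasure lebesgue U \<le> ennreal (2 powr (real_of_int b - 1))" by simp
  have Bb: "B b \<in> sets lebesgue" using insert by auto
  have "ennreal (2 powr (real_of_int b - 1)) + ennreal (2 powr (real_of_int b - 1)) = ennreal (2 powr real_of_int b)"
    by (simp add: powr_diff flip: ennreal_plus)
  also have "\<dots> \<le> emeasure lebesgue (B b)" using insert by auto
  also have "\<dots> \<le> emeasure lebesgue (U \<union> (B b - U))"
    using U Bb by (intro emeasure_mono) auto
  also have "\<dots> \<le> emeasure lebesgue U + emeasure lebesgue (B b - U)"
    using U Bb by (intro emeasure_subadditive) auto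
  also have "\<dots> \<le> ennreal (2 powr (real_of_int b - 1)) + emeasure lebesgue (B b - U)"
    using mU by (rule add_right_mono)
  finally have "ennreal (2 powr (real_of_int b - 1)) \<le> emeasure lebesgue (B b - U)"
    by (simp add: ennreal_add_left_cancel_le)
  then obtain C where C: "C \<in> sets lebesgue" "C \<subseteq> B b - U"
      "emeasure lebesgue C = ennreal (2 powr (real_of_int b - 1))"
    using lebesgue_subset_with_measure[of "B b - U" "2 powr (real_of_int b - 1)"] U Bb by auto
  show ?case
  proof (intro exI[of _ "A(b := C)"] conjI ballI)
    show "disjoint_family_on (A(b := C)) (insert b F)"
      using A(1) C(2) \<open>b \<notin> F\<close> unfolding disjoint_family_on_def U_def by auto
  qed (use A C \<open>b \<notin> F\<close> in auto)
qed (simp add: disjoint_family_on_def)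

section \<open>Quasi-norms of functions that are controlled on disjoint blocks\<close>

locale dyadic_blocks =
  fixes I :: "real set" and F :: "int set" and A :: "int \<Rightarrow> real set"
  assumes F: "finite F" "F \<subseteq> dyadic_indices I"
    and disj: "disjoint_family_on A F"
    and A: "\<And>k. k \<in> F \<Longrightarrow> A k \<in> sets (lebesgue_on I)"
      "\<And>k. k \<in> F \<Longrightarrow> emeasure (lebesgue_on I) (A k) = ennreal (2 powr (real_of_int k - 1))"
begin

definition step :: "(int \<Rightarrow> real) \<Rightarrow> real \<Rightarrow> real" where
  "step b s = (\<Sum>k\<in>F. b k * indicator (A k) s)"

lemma step_L0: "step b \<in> L0 I"
  unfolding L0_def step_def[abs_def] using A(1)
  by (intro borel_measurable_sum borel_measurable_times borel_measurable_const borel_measurable_indicator)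

lemma step_eq: 
  assumes "k \<in> F" "s \<in> A k"
  shows "step b s = b k"
proof -
  have "s \<notin> A j" if "j \<in> F - {k}" for j
    using disj assms that unfolding disjoint_family_on_def by blast
  then have "(\<Sum>j\<in>F - {k}. b j * indicator (A j) s) = 0"
    by (intro sum.neutral) auto
  then show ?thesis
    unfolding step_def using assms F(1) by (subst sum.remove[of F k]) auto
qed

lemma step_eq_0: "(\<And>k. k \<in> F \<Longrightarrow> s \<notin> A k) \<Longrightarrow> step b s = 0"
  unfolding step_def by (intro sum.neutral) auto

text \<open>\<open>A k\<close> has measure \<open>2^(k-1)\<close>, strictly above
  \<open>2^(k-2)\<close>, so the rearrangement at \<open>2^(k-2)\<close> is at least
  \<open>c k\<close>. Shifting the index by two costs \<open>2 powr (2 * e)\<close>.\<close>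

lemma lnorm_le_dyadic_norm:
  assumes "0 < q" "x \<in> L0 I" "\<And>k s. k \<in> F \<Longrightarrow> s \<in> A k \<Longrightarrow> c k \<le> \<bar>x s\<bar>"
  shows "lnorm q F (\<lambda>k. ennreal (2 powr (e * real_of_int k) * c k)) \<le> ennreal (2 powr (2 * e)) * dyadic_norm I e q x"
proof -
  let ?d = "\<lambda>k. ennreal (2 powr (e * real_of_int k)) * rearrangement I x (2 powr real_of_int k)"
  have "lnorm q F (\<lambda>k. ennreal (2 powr (e * real_of_int k) * c k)) \<le> lnorm q F (\<lambda>k. ennreal (2 powr (2 * e)) * ?d (k - 2))"
  proof (rule lnorm_mono)
    fix k assume k: "k \<in> F"
    have "ennreal (c k) \<le> rearrangement I x (2 powr real_of_int (k - 2))"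
    proof (rule rearrangement_ge[OF assms(2) A(1)[OF k]])
      show "ennreal (2 powr real_of_int (k - 2)) < emeasure (lebesgue_on I) (A k)"
        by (simp add: A(2)[OF k] ennreal_less_iff)
    qed (use assms k in auto)
    then have "ennreal (2 powr (2 * e)) * (ennreal (2 powr (e * real_of_int (k - 2))) * ennreal (c k))
        \<le> ennreal (2 powr (2 * e)) * ?d (k - 2)"
      by (intro mult_left_mono) auto
    moreover have "2 powr (e * real_of_int k) = 2 powr (2 * e) * 2 powr (e * real_of_int (k - 2))"
      by (simp add: algebra_simps flip: powr_add)
    ultimately show "ennreal (2 powr (e * real_of_int k) * c k) \<le> ennreal (2 powr (2 * e)) * ?d (k - 2)"
      by (simp only: mult.assoc ennreal_mult'[OF powr_ge_zero])
  qed (rule assms)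
  also have "\<dots> = ennreal (2 powr (2 * e)) * lnorm q F (\<lambda>k. ?d (k - 2))"
    by (rule lnorm_cmult[OF assms(1)])
  also have "\<dots> \<le> ennreal (2 powr (2 * e)) * dyadic_norm I e q x"
    unfolding dyadic_norm_def
  proof (intro mult_left_mono lnorm_inj[OF assms(1), of "\<lambda>k. k - 2" _ _ ?d])
    show "(\<lambda>k. k - 2) ` F \<subseteq> dyadic_indices I"
      using F(2) dyadic_indices_antimono[of _ I] by fastforce
  qed (auto simp: inj_on_def)
  finally show ?thesis .
qed

text \<open>The blocks of index at most \<open>k\<close> have total measure at most
  \<open>2^k\<close>; discarding them leaves only coefficients of larger index.\<close>

lemma rearrangement_step_le:
  assumes b: "\<And>k. 0 \<le> b k"
  shows "rearrangement I (step b) (2 powr real_of_int k) = 0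
    \<or> (\<exists>j\<in>F. k < j \<and> rearrangement I (step b) (2 powr real_of_int k) \<le> ennreal (b j))"
proof -
  define G where "G = {j\<in>F. k < j}"
  \<comment> \<open>The inserted 0 covers the case that no block has index above
    \<open>k\<close>.\<close>
  define c where "c = Max (insert 0 (b ` G))"
  have finG: "finite G" using F by (simp add: G_def)
  then have c: "0 \<le> c" "\<And>j. j \<in> G \<Longrightarrow> b j \<le> c" "c \<in> insert 0 (b ` G)"
    unfolding c_def using Max_in[of "insert 0 (b ` G)"] by auto
  have "{s\<in>I. c < \<bar>step b s\<bar>} \<subseteq> (\<Union>j\<in>F - G. A j)"
  proof
    fix s assume s: "s \<in> {s\<in>I. c < \<bar>step b s\<bar>}"
    then have "step b s \<noteq> 0" using c(1) by auto
    then obtain j where j: "j \<in> F" "s \<in> A j" using step_eq_0 by blast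
    with s have "c < b j" using b step_eq[OF j] by simp
    then have "j \<notin> G" using c(2)[of j] by auto
    with j show "s \<in> (\<Union>j\<in>F - G. A j)" by blast
  qed
  then have "emeasure (lebesgue_on I) {s\<in>I. c < \<bar>step b s\<bar>} \<le> emeasure (lebesgue_on I) (\<Union>j\<in>F - G. A j)"
    using A F by (intro emeasure_mono) auto
  also have "\<dots> \<le> (\<Sum>j\<in>F - G. emeasure (lebesgue_on I) (A j))"
    using A F by (intro emeasure_subadditive_finite) auto
  also have "\<dots> = ennreal (\<Sum>j\<in>F - G. 2 powr (real_of_int j - 1))"
    using A by (simp add: sum_ennreal)
  also have "\<dots> \<le> ennreal (2 powr real_of_int k)"
    using F by (intro ennreal_leI sum_powr_2_le) (auto simp: G_def)
  finally have "rearrangement I (step b) (2 powr real_of_int k) \<le> ennreal c"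
    using rearrangement_le_iff[OF step_L0 c(1)] by simp
  with c(3) show ?thesis by (auto simp: G_def)
qed

text \<open>A coefficient of index \<open>k + n\<close> seen at scale \<open>k\<close> carries the
  weight \<open>2 powr (e * k)\<close>, which is \<open>(2 powr - e) ^ n\<close> times its own
  weight. As \<open>e > 0\<close> these factors are geometric, and the order of the coefficients
  does not matter.\<close>

lemma dyadic_norm_step_le:
  assumes "0 < q" "0 < e" and b: "\<And>k. 0 \<le> b k"
  shows "dyadic_norm I e q (step b)
    \<le> ennreal (geometric_const q (2 powr - e)) * lnorm q F (\<lambda>k. ennreal (2 powr (e * real_of_int k) * b k))"
proof -
  \<comment> \<open>Extension by 0, since the shifted index \<open>k + n\<close> may leave
    \<open>F\<close>.\<close>
  define v where "v j = (if j \<in> F then ennreal (2 powr (e * real_of_int j) * b j) else 0)" for j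
  have "lnorm q (dyadic_indices I) (\<lambda>k. v (k + int n)) \<le> lnorm q UNIV v" for n
    by (rule lnorm_inj[OF assms(1)]) (auto simp: inj_on_def)
  also have "lnorm q UNIV v \<le> lnorm q F v"
    using assms by (intro lnorm_le_zero_outside) (auto simp: v_def)
  finally have w: "lnorm q (dyadic_indices I) (\<lambda>k. v (k + int n)) \<le> lnorm q F v" for n .
  have "2 powr - e < 1" using assms(2) powr_less_mono[of "-e" 0 2] by simp
  have "dyadic_norm I e q (step b) \<le> ennreal (geometric_const q (2 powr - e)) * lnorm q F v"
    unfolding dyadic_norm_def
  proof (rule lnorm_geometric_SUP_le[OF assms(1) _ \<open>2 powr - e < 1\<close> w])
    fix k
    show "ennreal (2 powr (e * real_of_int k)) * rearrangement I (step b) (2 powr real_of_int k)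
        \<le> (SUP n. ennreal ((2 powr - e) ^ n) * v (k + int n))"
    proof (cases "rearrangement I (step b) (2 powr real_of_int k) = 0")
      case False
      then obtain j where 1: "j \<in> F" "k < j" "rearrangement I (step b) (2 powr real_of_int k) \<le> ennreal (b j)"
        using rearrangement_step_le[of b k] b by blast
      define n where "n = nat (j - k)"
      have n: "j = k + int n" using 1 by (simp add: n_def)
      have "2 powr (e * real_of_int k) = (2 powr - e) ^ n * 2 powr (e * real_of_int j)"
        by (simp add: n algebra_simps flip: powr_realpow powr_add add: powr_powr)
      then have "ennreal (2 powr (e * real_of_int k)) * ennreal (b j) = ennreal ((2 powr - e) ^ n) * v (k + int n)"
        using 1 b n by (simp add: v_def flip: ennreal_mult)
      then show ?thesis
        using mult_left_mono[OF 1(3), of "ennreal (2 powr (e * real_of_int k))"]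
        by (intro SUP_upper2[of n]) auto
    qed simp
  qed simp
  also have "lnorm q F v = lnorm q F (\<lambda>k. ennreal (2 powr (e * real_of_int k) * b k))"
    by (rule lnorm_cong) (simp add: v_def)
  finally show ?thesis .
qed

end

section \<open>Monotonicity, products and countable majorants\<close>

lemma lorentz_norm_mono:
  assumes "0 < q" "x \<in> L0 I" "y \<in> L0 I" "AE s in lebesgue_on I. \<bar>x s\<bar> \<le> \<bar>y s\<bar>"
  shows "lorentz_norm I p q x \<le> lorentz_norm I p q y"
proof -
  note le = rearrangement_mono[OF assms(2-4)]
  from assms(1) show ?thesis
  proof (cases rule: ennreal_exponent_cases)
    case top
    then show ?thesis
      by (auto simp: lorentz_norm_def intro!: SUP_mono' mult_left_mono le)
  next
    case (real r)
    then show ?thesis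
      by (auto simp: lorentz_norm_eq_lborel divide_ennreal_def
          intro!: epowr_mono nn_integral_mono mult_right_mono mult_left_mono le)
  qed
qed

lemma lorentz_norm_cmult:
  assumes "0 < q" "x \<in> L0 I" "0 < a"
  shows "lorentz_norm I p q (\<lambda>s. a * x s) = ennreal a * lorentz_norm I p q x"
proof -
  note eq = rearrangement_cmult[OF assms(2,3)]
  from assms(1) show ?thesis
  proof (cases rule: ennreal_exponent_cases)
    case top
    then show ?thesis
      by (simp add: lorentz_norm_def eq SUP_mult_left_ennreal mult.left_commute)
  next
    case (real r)
    define e where "e = enn2real (1 / p)"
    define J where "J = {t. 0 < t \<and> ennreal t < emeasure lebesgue I}"
    have "(\<integral>\<^sup>+t. epowr (ennreal (t powr e) * (ennreal a * rearrangement I x t)) r / ennreal t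
        * indicator J t \<partial>lborel)
      = (\<integral>\<^sup>+t. epowr (ennreal a) r * (epowr (ennreal (t powr e) * rearrangement I x t) r / ennreal t
        * indicator J t) \<partial>lborel)"
      by (intro nn_integral_cong) (simp only: epowr_mult divide_ennreal_def mult_ac)
    also have "\<dots> = epowr (ennreal a) r * (\<integral>\<^sup>+t. epowr (ennreal (t powr e) * rearrangement I x t) r / ennreal t
        * indicator J t \<partial>lborel)"
      using lorentz_integrand_measurable unfolding J_def by (intro nn_integral_cmult) simp
    finally have "lorentz_norm I p q (\<lambda>s. a * x s) = epowr (epowr (ennreal a) r) (1 / r) * lorentz_norm I p q x"
      using real by (simp only: lorentz_norm_eq_lborel eq e_def J_def epowr_mult)
    then show ?thesis using real by (simp only: epowr_epowr) simp
  qed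
qed

section \<open>Lorentz spaces and products in terms of the dyadic quasi-norm\<close>

lemma lorentz_iff_dyadic_norm:
  assumes "0 < q"
  shows "x \<in> lorentz I p q \<longleftrightarrow> x \<in> L0 I \<and> dyadic_norm I (enn2real (1 / p)) q x < top"
proof -
  have "lorentz_norm I p q x < top \<longleftrightarrow> dyadic_norm I (enn2real (1 / p)) q x < top"
    using lorentz_norm_le_dyadic_norm[OF assms, of I p x] dyadic_norm_le_lorentz_norm[OF assms, of I p x]
    by (auto elim!: le_less_trans simp: ennreal_mult_less_top)
  then show ?thesis by (simp add: lorentz_def)
qed

text \<open>Write \<open>2^k\<close> as twice \<open>2^(k-1)\<close>, bound the rearrangement of the
  product by the two rearrangements at \<open>2^(k-1)\<close>, split the weight by
  \<open>e2 = e3 + e1\<close>, and apply Hoelder to the shifted sequences. The positive bounds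
  \<alpha>, \<beta> normalize even when a quasi-norm vanishes.\<close>

lemma dyadic_norm_mult_le:
  assumes "0 < q1" "0 < q2" "1 / q3 = (if q1 > q2 then 1 / q2 - 1 / q1 else 0)"
    and q3: "0 < q3" and e: "e2 = e3 + e1" and ab: "0 < \<alpha>" "0 < \<beta>"
    and x: "x \<in> L0 I" "dyadic_norm I e3 q3 x \<le> ennreal \<alpha>"
    and y: "y \<in> L0 I" "dyadic_norm I e1 q1 y \<le> ennreal \<beta>"
  shows "dyadic_norm I e2 q2 (\<lambda>s. x s * y s)
    \<le> ennreal (2 powr e2 * 2 powr (1 / enn2real q2) * (\<alpha> * \<beta>))"
proof -
  define S where "S = dyadic_indices I"
  define u where "u k = ennreal (2 powr (e3 * real_of_int k)) * rearrangement I x (2 powr real_of_int k)" for k :: int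
  define v where "v k = ennreal (2 powr (e1 * real_of_int k)) * rearrangement I y (2 powr real_of_int k)" for k :: int
  define w where "w k = ennreal (1 / \<alpha>) * u k * (ennreal (1 / \<beta>) * v k)" for k
  have "lnorm q3 S (\<lambda>k. ennreal (1 / \<alpha>) * u k) \<le> ennreal (1 / \<alpha>) * ennreal \<alpha>"
    using x(2) q3 unfolding dyadic_norm_def u_def S_def lnorm_cmult[OF q3] by (intro mult_left_mono) auto
  moreover have "lnorm q1 S (\<lambda>k. ennreal (1 / \<beta>) * v k) \<le> ennreal (1 / \<beta>) * ennreal \<beta>"
    using y(2) assms(1) unfolding dyadic_norm_def v_def S_def lnorm_cmult[OF assms(1)] by (intro mult_left_mono) auto
  ultimately have w: "lnorm q2 S w \<le> epowr 2 (1 / enn2real q2)"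
    unfolding w_def using ab by (intro lnorm_Hoelder[OF assms(1-3)]) (auto simp flip: ennreal_mult)
  have pred: "k - 1 \<in> S" if "k \<in> S" for k
    using that dyadic_indices_antimono[of k I "k - 1"] by (simp add: S_def)
  have "dyadic_norm I e2 q2 (\<lambda>s. x s * y s) \<le> lnorm q2 S (\<lambda>k. ennreal (2 powr e2 * (\<alpha> * \<beta>)) * w (k - 1))"
    unfolding dyadic_norm_def S_def[symmetric]
  proof (rule lnorm_mono[OF assms(2)])
    fix k assume k: "k \<in> S"
    define t where "t = 2 powr real_of_int (k - 1)"
    have t: "2 powr real_of_int k = t + t" by (simp add: t_def powr_diff)
    have "u (k - 1) \<le> ennreal \<alpha>"
      using lnorm_ge_point[OF q3 pred[OF k], of u] x(2)
      unfolding dyadic_norm_def S_def u_def by (rule order_trans)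
    moreover have "v (k - 1) \<le> ennreal \<beta>"
      using lnorm_ge_point[OF assms(1) pred[OF k], of v] y(2)
      unfolding dyadic_norm_def S_def v_def by (rule order_trans)
    \<comment> \<open>Each term is at most the whole quasi-norm, which makes the rearrangements
      finite as the product estimate requires.\<close>
    ultimately have "u (k - 1) < top" "v (k - 1) < top"
      using le_less_trans ennreal_less_top by blast+
    then have "rearrangement I x t < top" "rearrangement I y t < top"
      by (auto simp: u_def v_def t_def ennreal_mult_less_top)
    then have le: "rearrangement I (\<lambda>s. x s * y s) (t + t) \<le> rearrangement I x t * rearrangement I y t"
      by (intro rearrangement_mult_le x y) (auto simp: t_def)
    have "2 powr (e2 * real_of_int k) = 2 powr e2 * (\<alpha> * \<beta>) * ((1 / \<alpha> * 2 powr (e3 * real_of_int (k - 1))) * (1 / \<beta> * 2 powr (e1 * real_of_int (k - 1))))"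
      using ab by (simp add: e algebra_simps flip: powr_add)
    then have "ennreal (2 powr (e2 * real_of_int k)) = ennreal (2 powr e2 * (\<alpha> * \<beta>)) *
       ((ennreal (1 / \<alpha>) * ennreal (2 powr (e3 * real_of_int (k - 1)))) * (ennreal (1 / \<beta>) * ennreal (2 powr (e1 * real_of_int (k - 1)))))"
      using ab by (simp add: ennreal_mult[symmetric])
    moreover have "ennreal (2 powr (e2 * real_of_int k)) * rearrangement I (\<lambda>s. x s * y s) (2 powr real_of_int k)
      \<le> ennreal (2 powr (e2 * real_of_int k)) * (rearrangement I x t * rearrangement I y t)"
      unfolding t by (intro mult_left_mono le) auto
    ultimately show "ennreal (2 powr (e2 * real_of_int k)) * rearrangement I (\<lambda>s. x s * y s) (2 powr real_of_int k)
      \<le> ennreal (2 powr e2 * (\<alpha> * \<beta>)) * w (k - 1)"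
      by (simp only: w_def u_def v_def t_def mult_ac)
  qed
  also have "\<dots> = ennreal (2 powr e2 * (\<alpha> * \<beta>)) * lnorm q2 S (\<lambda>k. w (k - 1))"
    by (rule lnorm_cmult[OF assms(2)])
  also have "\<dots> \<le> ennreal (2 powr e2 * (\<alpha> * \<beta>)) * ennreal (2 powr (1 / enn2real q2))"
  proof (rule mult_left_mono)
    have "lnorm q2 S (\<lambda>k. w (k - 1)) \<le> lnorm q2 S w"
      using pred by (intro lnorm_inj[OF assms(2)]) (auto simp: inj_on_def)
    also note w
    also have "epowr 2 (1 / enn2real q2) = ennreal (2 powr (1 / enn2real q2))"
      using epowr_ennreal[of 2 "1 / enn2real q2"] by simp
    finally show "lnorm q2 S (\<lambda>k. w (k - 1)) \<le> ennreal (2 powr (1 / enn2real q2))" .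
  qed simp
  finally show ?thesis
    using ab by (simp add: mult_ac flip: ennreal_mult)
qed

text \<open>This takes the place of completeness. To bound the supremum at scale \<open>2^k\<close>,
  the function \<open>y n\<close> is allowed measure \<open>2^(k-n-1)\<close>; these sum to
  \<open>2^k\<close>. The weight \<open>c n\<close> absorbs the shift by \<open>n + 1\<close> in the
  factor \<open>2 powr (e * k)\<close> and leaves \<open>2^(-n-1)\<close> for summation.\<close>

lemma dyadic_norm_countable_majorant:
  fixes y :: "nat \<Rightarrow> real \<Rightarrow> real"
  assumes I: "I \<in> sets lebesgue" and "0 < q" and y: "\<And>n. y n \<in> L0 I"
    and B: "\<And>n. dyadic_norm I e q (y n) \<le> B" "B < top"
  defines "c \<equiv> \<lambda>n. 2 powr (- (e + 1) * (real n + 1))"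
  obtains Y where "Y \<in> L0 I" "dyadic_norm I e q Y < top"
    "\<And>n. AE s in lebesgue_on I. c n * \<bar>y n s\<bar> \<le> \<bar>Y s\<bar>"
proof -
  have c: "0 < c n" for n by (simp add: c_def)
  define Z where "Z s = (SUP n. ennreal (c n * \<bar>y n s\<bar>))" for s
  \<comment> \<open>\<open>Y\<close> is \<open>0\<close> where \<open>Z\<close> is infinite, so it majorizes only after that set is shown to be null.\<close>
  define Y where "Y s = enn2real (Z s)" for s
  have [measurable]: "y n \<in> borel_measurable (lebesgue_on I)" for n
    using y by (rule L0_measurable)
  have Z [measurable]: "Z \<in> borel_measurable (lebesgue_on I)"
    unfolding Z_def[abs_def] by measurable
  have Y: "Y \<in> L0 I"
    unfolding L0_def Y_def[abs_def] by measurable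
  \<comment> \<open>\<open>\<Lambda> k\<close> is the resulting bound for the rearrangement of the
    supremum at \<open>2^k\<close>.\<close>
  define \<Lambda> where "\<Lambda> k = (SUP n. ennreal (c n) * rearrangement I (y n) (2 powr (real_of_int k - real n - 1)))" for k :: int
  have measZ: "emeasure (lebesgue_on I) {s\<in>I. ennreal l < Z s} \<le> ennreal (2 powr real_of_int k)"
    if "\<Lambda> k \<le> ennreal l" "0 \<le> l" for k l
  proof -
    define E where "E n = {s\<in>I. l / c n < \<bar>y n s\<bar>}" for n
    have E: "E n \<in> sets (lebesgue_on I)" for n
      unfolding E_def by (rule superlevel_sets[OF y])
    have mE: "emeasure (lebesgue_on I) (E n) \<le> ennreal (2 powr real_of_int k * (1 / 2) ^ Suc n)" for n
    proof -
      have "ennreal (c n) * rearrangement I (y n) (2 powr (real_of_int k - real n - 1)) \<le> ennreal l"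
        using that(1) unfolding \<Lambda>_def SUP_le_iff by blast
      then have "ennreal (1 / c n) * (ennreal (c n) * rearrangement I (y n) (2 powr (real_of_int k - real n - 1)))
          \<le> ennreal (1 / c n) * ennreal l"
        by (rule mult_left_mono) simp
      then have "rearrangement I (y n) (2 powr (real_of_int k - real n - 1)) \<le> ennreal (l / c n)"
        using c[of n] that(2) by (simp add: mult.assoc[symmetric] ennreal_mult[symmetric])
      then have "emeasure (lebesgue_on I) (E n) \<le> ennreal (2 powr (real_of_int k - real n - 1))"
        unfolding E_def using rearrangement_le_iff[OF y, of "l / c n" n] c[of n] that(2) by simp
      also have "2 powr (real_of_int k - real n - 1) = 2 powr real_of_int k * (1 / 2) ^ Suc n"
        by (simp add: powr_diff powr_realpow power_one_over)
      finally show ?thesis .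
    qed
    have "{s\<in>I. ennreal l < Z s} \<subseteq> (\<Union>n. E n)"
    proof
      fix s assume "s \<in> {s\<in>I. ennreal l < Z s}"
      then obtain n where "s \<in> I" "ennreal l < ennreal (c n * \<bar>y n s\<bar>)"
        unfolding Z_def less_SUP_iff by blast
      then have "l / c n < \<bar>y n s\<bar>"
        using c[of n] that(2) by (simp add: ennreal_less_iff field_simps)
      with \<open>s \<in> I\<close> show "s \<in> (\<Union>n. E n)" unfolding E_def by blast
    qed
    then have "emeasure (lebesgue_on I) {s\<in>I. ennreal l < Z s} \<le> emeasure (lebesgue_on I) (\<Union>n. E n)"
      using E by (intro emeasure_mono) auto
    also have "\<dots> \<le> (\<Sum>n. emeasure (lebesgue_on I) (E n))"
      using E by (intro emeasure_subadditive_countably) auto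
    also have "\<dots> \<le> (\<Sum>n. ennreal (2 powr real_of_int k * (1 / 2) ^ Suc n))"
      by (intro suminf_le mE) auto
    also have "\<dots> = ennreal (2 powr real_of_int k * 1)"
      using sums_mult[OF power_half_series, of "2 powr real_of_int k"]
      by (intro suminf_ennreal_eq) auto
    finally show ?thesis by simp
  qed
  have cshift: "2 powr (e * real_of_int k) * c n
      = (1 / 2) ^ Suc n * 2 powr (e * real_of_int (k - int n - 1))" for k n
  proof -
    have "(1 / 2 :: real) ^ Suc n = 2 powr - (real n + 1)"
    proof -
      have "2 powr - (real n + 1) = inverse (2 powr real (Suc n))"
        by (simp only: powr_minus of_nat_Suc add.commute)
      also have "\<dots> = (1 / 2) ^ Suc n"
        by (subst powr_realpow) (simp_all add: power_one_over inverse_eq_divide)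
      finally show ?thesis by simp
    qed
    then show ?thesis
      by (simp add: c_def algebra_simps flip: powr_add)
  qed
  define w where "w n k = ennreal (2 powr (e * real_of_int (k - int n - 1)))
     * rearrangement I (y n) (2 powr real_of_int (k - int n - 1))" for n :: nat and k :: int
  have w: "lnorm q (dyadic_indices I) (w n) \<le> B" for n
  proof -
    have "lnorm q (dyadic_indices I) (w n) \<le> dyadic_norm I e q (y n)"
      unfolding dyadic_norm_def w_def
      by (rule lnorm_inj[OF \<open>0 < q\<close>, of "\<lambda>k. k - int n - 1"])
         (auto simp: inj_on_def intro: dyadic_indices_antimono)
    also note B(1)
    finally show ?thesis .
  qed
  have \<Lambda>: "ennreal (2 powr (e * real_of_int k)) * \<Lambda> k = (SUP n. ennreal ((1 / 2) ^ Suc n) * w n k)" for k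
  proof -
    have "ennreal (2 powr (e * real_of_int k)) * (ennreal (c n) * rearrangement I (y n) (2 powr (real_of_int k - real n - 1)))
      = ennreal ((1 / 2) ^ Suc n) * w n k" for n
      using c[of n] cshift[of k n] unfolding w_def
      by (simp add: mult.assoc[symmetric] ennreal_mult[symmetric] del: power_Suc)
    then show ?thesis unfolding \<Lambda>_def SUP_mult_left_ennreal by simp
  qed
  have Yle: "rearrangement I Y (2 powr real_of_int k) \<le> \<Lambda> k" for k
  proof (cases "\<Lambda> k")
    case (real l)
    \<comment> \<open>Holds without knowing where \<open>Z\<close> is infinite, because
      \<open>Y\<close> is 0 there and \<open>l \<ge> 0\<close>.\<close>
    have "{s\<in>I. l < \<bar>Y s\<bar>} \<subseteq> {s\<in>I. ennreal l < Z s}"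
    proof safe
      fix s assume "l < \<bar>Y s\<bar>"
      then show "ennreal l < Z s"
        using real by (cases "Z s") (auto simp: Y_def ennreal_less_iff)
    qed
    moreover have "{s\<in>I. ennreal l < Z s} \<in> sets (lebesgue_on I)"
    proof -
      have "{s\<in>space (lebesgue_on I). ennreal l < Z s} \<in> sets (lebesgue_on I)" by measurable
      then show ?thesis by simp
    qed
    ultimately have "emeasure (lebesgue_on I) {s\<in>I. l < \<bar>Y s\<bar>} \<le> emeasure (lebesgue_on I) {s\<in>I. ennreal l < Z s}"
      by (rule emeasure_mono)
    also have "\<dots> \<le> ennreal (2 powr real_of_int k)"
      using real by (intro measZ) auto
    finally show ?thesis
      using rearrangement_le_iff[OF Y real(1)] real by simp
  qed simp
  have "dyadic_norm I e q Y \<le> ennreal (geometric_const q (1 / 2)) * B"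
    unfolding dyadic_norm_def
  proof (rule lnorm_geometric_SUP_le[OF \<open>0 < q\<close> _ _ w])
    fix k
    have "ennreal (2 powr (e * real_of_int k)) * rearrangement I Y (2 powr real_of_int k)
        \<le> ennreal (2 powr (e * real_of_int k)) * \<Lambda> k"
      by (intro mult_left_mono Yle) auto
    also have "\<dots> \<le> (SUP n. ennreal ((1 / 2) ^ n) * w n k)"
      unfolding \<Lambda> by (intro SUP_mono' mult_right_mono ennreal_leI) auto
    finally show "ennreal (2 powr (e * real_of_int k)) * rearrangement I Y (2 powr real_of_int k)
        \<le> (SUP n. ennreal ((1 / 2) ^ n) * w n k)" .
  qed auto
  then have fin: "dyadic_norm I e q Y < top"
    by (rule le_less_trans) (use B(2) in \<open>simp add: ennreal_mult_less_top\<close>)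
  \<comment> \<open>For indices in range \<open>\<Lambda> k\<close> is finite, since every weighted
    term is at most \<open>B\<close>; for the others \<open>I\<close> itself has measure at most
    \<open>2^k\<close>. Letting \<open>k\<close> decrease shows that \<open>Z\<close> is finite
    almost everywhere.\<close>
  have null: "emeasure (lebesgue_on I) {s\<in>I. Z s = top} \<le> ennreal (2 powr real_of_int k)" for k
  proof (cases "k \<in> dyadic_indices I")
    case False
    then have "emeasure lebesgue I \<le> ennreal (2 powr real_of_int k)"
      by (simp add: dyadic_indices_def)
    moreover have "emeasure (lebesgue_on I) {s\<in>I. Z s = top} \<le> emeasure (lebesgue_on I) (space (lebesgue_on I))"
      by (rule emeasure_space)
    ultimately show ?thesis
      using I by (simp add: emeasure_restrict_space)
  next
    case True
    have "ennreal ((1 / 2) ^ Suc n) * w n k \<le> 1 * B" for n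
      using lnorm_ge_point[OF \<open>0 < q\<close> True, of "w n"] w[of n]
      by (intro mult_mono) (auto simp: power_le_one simp del: power_Suc)
    then have "ennreal (2 powr (e * real_of_int k)) * \<Lambda> k \<le> B"
      unfolding \<Lambda> by (intro SUP_least) auto
    then have "ennreal (2 powr (e * real_of_int k)) * \<Lambda> k < top"
      using B(2) by (rule le_less_trans)
    then have "\<Lambda> k < top" by (auto simp: ennreal_mult_less_top)
    then obtain l where l: "0 \<le> l" "\<Lambda> k = ennreal l" by (cases "\<Lambda> k") auto
    have "{s\<in>space (lebesgue_on I). ennreal l < Z s} \<in> sets (lebesgue_on I)" by measurable
    then have "emeasure (lebesgue_on I) {s\<in>I. Z s = top} \<le> emeasure (lebesgue_on I) {s\<in>I. ennreal l < Z s}"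
      by (intro emeasure_mono) auto
    also have "\<dots> \<le> ennreal (2 powr real_of_int k)"
      using l by (intro measZ) auto
    finally show ?thesis .
  qed
  have "emeasure (lebesgue_on I) {s\<in>I. Z s = top} = 0"
  proof (rule ccontr)
    assume "\<not> ?thesis"
    then obtain z where z: "0 < z" "z < emeasure (lebesgue_on I) {s\<in>I. Z s = top}"
      using dense[of 0 "emeasure (lebesgue_on I) {s\<in>I. Z s = top}"]
      by (auto simp: zero_less_iff_neq_zero)
    then obtain r where r: "0 < r" "ennreal r < emeasure (lebesgue_on I) {s\<in>I. Z s = top}"
      by (cases z) auto
    from dyadic_floor[OF r(1)] obtain k :: int where "2 powr real_of_int k \<le> r" by blast
    with null[of k] r(2) show False
      using ennreal_leI[of "2 powr real_of_int k" r] by auto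
  qed
  moreover have "{s\<in>I. Z s = top} \<in> sets (lebesgue_on I)"
  proof -
    have "Z -` {top} \<inter> space (lebesgue_on I) \<in> sets (lebesgue_on I)"
      by (rule measurable_sets[OF Z]) simp
    then show ?thesis by (simp add: vimage_def Int_def conj_commute)
  qed
  ultimately have AE: "AE s in lebesgue_on I. Z s \<noteq> top"
    by (intro AE_I[of _ _ "{s\<in>I. Z s = top}"]) auto
  have "AE s in lebesgue_on I. c n * \<bar>y n s\<bar> \<le> \<bar>Y s\<bar>" for n
    using AE
  proof eventually_elim
    case (elim s)
    have "ennreal (c n * \<bar>y n s\<bar>) \<le> Z s" unfolding Z_def by (rule SUP_upper) simp
    with elim show ?case by (cases "Z s") (auto simp: Y_def)
  qed
  with Y fin show ?thesis by (rule that)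
qed

section \<open>Multipliers\<close>

locale lorentz_multipliers =
  fixes I :: "real set" and p1 p2 q1 q2 :: ennreal
  assumes I: "I \<in> sets lebesgue"
    and p: "0 < p1" "p1 < \<infinity>" "0 < p2" "p2 < \<infinity>" and q: "0 < q1" "0 < q2"
begin

definition e1 :: real where "e1 = enn2real (1 / p1)"
definition e2 :: real where "e2 = enn2real (1 / p2)"

abbreviation M where "M \<equiv> multipliers I (lorentz I p1 q1) (lorentz I p2 q2)"
abbreviation Mnorm where
  "Mnorm \<equiv> multiplier_norm (lorentz I p1 q1) (lorentz_norm I p1 q1) (lorentz_norm I p2 q2)"

lemma e1_pos: "0 < e1"
  unfolding e1_def using p by (cases p1) (auto simp: divide_ennreal simp flip: ennreal_1)

text \<open>The multiplier quasi-norm only looks at unit vectors, so \<open>y\<close> is rescaled by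
  its positive finite quasi-norm.\<close>

lemma lorentz_norm_mult_le:
  assumes x: "x \<in> L0 I" and y: "y \<in> lorentz I p1 q1" "0 < lorentz_norm I p1 q1 y"
  shows "lorentz_norm I p2 q2 (\<lambda>s. x s * y s) \<le> Mnorm x * lorentz_norm I p1 q1 y"
proof -
  have yL: "y \<in> L0 I" and "lorentz_norm I p1 q1 y < top"
    using y by (auto simp: lorentz_def)
  then obtain b where b: "0 < b" "lorentz_norm I p1 q1 y = ennreal b"
    using y by (cases "lorentz_norm I p1 q1 y") auto
  define z where "z s = 1 / b * y s" for s
  have z: "z \<in> L0 I" "lorentz_norm I p1 q1 z = 1"
    using lorentz_norm_cmult[OF q(1) yL, of "1 / b" p1] L0_cmult[OF yL, of "1 / b"] b
    by (auto simp: z_def[abs_def] simp flip: ennreal_mult)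
  then have "z \<in> lorentz I p1 q1" by (simp add: lorentz_def)
  with z have "lorentz_norm I p2 q2 (\<lambda>s. x s * z s) \<le> Mnorm x"
    unfolding multiplier_norm_def by (intro SUP_upper) auto
  moreover have "(\<lambda>s. x s * y s) = (\<lambda>s. b * (x s * z s))"
    using b by (auto simp: z_def)
  ultimately show ?thesis
    using lorentz_norm_cmult[OF q(2) L0_mult[OF x z(1)] b(1), of p2]
    by (simp add: b(2) mult.commute mult_left_mono)
qed

text \<open>Otherwise some unit vectors \<open>y n\<close> have products beyond
  \<open>n / c n\<close>. Their majorant \<open>Y\<close> is in the domain, while the product with
  \<open>Y\<close> dominates \<open>c n\<close> times each of these products, so its quasi-norm
  exceeds every \<open>n\<close>.\<close>

lemma Mnorm_finite:
  assumes x: "x \<in> M"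
  shows "Mnorm x < top"
proof (rule ccontr)
  assume "\<not> ?thesis"
  then have top: "Mnorm x = top" using less_top by blast
  have xL: "x \<in> L0 I" using x by (simp add: multipliers_def)
  define c where "c n = 2 powr (- (e1 + 1) * (real n + 1))" for n :: nat
  have c: "0 < c n" for n by (simp add: c_def)
  have "\<exists>y\<in>lorentz I p1 q1. lorentz_norm I p1 q1 y = 1 \<and>
      ennreal (real n / c n) < lorentz_norm I p2 q2 (\<lambda>s. x s * y s)" for n
  proof -
    have "ennreal (real n / c n) < Mnorm x" using top by simp
    then show ?thesis unfolding multiplier_norm_def less_SUP_iff by auto
  qed
  then obtain y where y: "\<And>n. y n \<in> lorentz I p1 q1" "\<And>n. lorentz_norm I p1 q1 (y n) = 1"
    "\<And>n. ennreal (real n / c n) < lorentz_norm I p2 q2 (\<lambda>s. x s * y n s)"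
    by metis
  have yL: "y n \<in> L0 I" for n using y(1)[of n] by (simp add: lorentz_def)
  obtain C where C: "\<And>z. dyadic_norm I e1 q1 z \<le> ennreal C * lorentz_norm I p1 q1 z"
    using dyadic_norm_le_lorentz_norm[OF q(1), of I p1] unfolding e1_def by blast
  have bound: "dyadic_norm I e1 q1 (y n) \<le> ennreal C" for n
    using C[of "y n"] y(2)[of n] by simp
  obtain Y where Y: "Y \<in> L0 I" "dyadic_norm I e1 q1 Y < top"
      "\<And>n. AE s in lebesgue_on I. c n * \<bar>y n s\<bar> \<le> \<bar>Y s\<bar>"
    using dyadic_norm_countable_majorant[where y = y, OF I q(1) yL bound ennreal_less_top]
    unfolding c_def by blast
  then have "Y \<in> lorentz I p1 q1"
    using lorentz_iff_dyadic_norm[OF q(1)] by (simp add: e1_def)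
  with x have xY: "(\<lambda>s. x s * Y s) \<in> lorentz I p2 q2"
    by (simp add: multipliers_def)
  have "ennreal (real n) \<le> lorentz_norm I p2 q2 (\<lambda>s. x s * Y s)" for n
  proof -
    have "ennreal (real n) = ennreal (c n) * ennreal (real n / c n)"
      using c[of n] by (simp flip: ennreal_mult)
    also have "\<dots> \<le> ennreal (c n) * lorentz_norm I p2 q2 (\<lambda>s. x s * y n s)"
      using y(3)[of n] by (intro mult_left_mono) auto
    also have "\<dots> = lorentz_norm I p2 q2 (\<lambda>s. c n * (x s * y n s))"
      by (rule lorentz_norm_cmult[OF q(2) L0_mult[OF xL yL] c, symmetric])
    also have "\<dots> \<le> lorentz_norm I p2 q2 (\<lambda>s. x s * Y s)"
    proof (rule lorentz_norm_mono[OF q(2)])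
      show "AE s in lebesgue_on I. \<bar>c n * (x s * y n s)\<bar> \<le> \<bar>x s * Y s\<bar>"
        using Y(3)[of n]
      proof eventually_elim
        case (elim s)
        then have "\<bar>x s\<bar> * (c n * \<bar>y n s\<bar>) \<le> \<bar>x s\<bar> * \<bar>Y s\<bar>"
          by (rule mult_left_mono) simp
        then show ?case using c[of n] by (simp add: abs_mult mult_ac)
      qed
    qed (intro L0_cmult L0_mult xL yL Y(1))+
    finally show ?thesis .
  qed
  moreover have "lorentz_norm I p2 q2 (\<lambda>s. x s * Y s) < top"
    using xY by (simp add: lorentz_def)
  then obtain r where "lorentz_norm I p2 q2 (\<lambda>s. x s * Y s) = ennreal r" "0 \<le> r"
    by (cases "lorentz_norm I p2 q2 (\<lambda>s. x s * Y s)") auto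
  ultimately have "real n \<le> r" for n by simp
  then show False using reals_Archimedean2[of r] by (meson not_less)
qed

text \<open>The losses of the test in order: from the coefficients of the product to its dyadic
  quasi-norm, from there to its Lorentz quasi-norm, and from the Lorentz quasi-norm of the step
  function back to its coefficients.\<close>

definition test_const :: real where
  "test_const = 2 powr (2 * e2) * ((if q2 = top then 1 else 2 powr (1 / enn2real q2)) * 2 powr e2)
     * (2 powr e1 * geometric_const q1 (2 powr - e1))"

lemma test_const_pos: "0 < test_const"
  using geometric_const_pos[OF q(1), of "2 powr - e1"] e1_pos powr_less_mono[of "- e1" 0 2]
  by (simp add: test_const_def)

text \<open>Testing a multiplier on step functions over disjoint sets \<open>A\<^sub>k \<subseteq> {\<mu>\<^sub>k \<le> \<bar>x\<bar>}\<close> of measure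
  \<open>2\<^sup>k\<^sup>-\<^sup>1\<close>: since the dyadic quasi-norm of such a step function does not see whether its coefficients are
  monotone, \<open>b\<close> is arbitrary and no level function is needed.\<close>

lemma lnorm_mult_le_Mnorm:
  assumes x: "x \<in> L0 I" and F: "finite F" "F \<subseteq> dyadic_indices I"
    and \<mu>: "\<And>k. k \<in> F \<Longrightarrow> ennreal (2 powr real_of_int k) \<le> emeasure (lebesgue_on I) {s\<in>I. \<mu> k \<le> \<bar>x s\<bar>}"
    and b: "\<And>k. 0 \<le> b k"
  shows "lnorm q2 F (\<lambda>k. ennreal (2 powr (e2 * real_of_int k) * (\<mu> k * b k)))
    \<le> ennreal test_const * Mnorm x * lnorm q1 F (\<lambda>k. ennreal (2 powr (e1 * real_of_int k) * b k))"
    (is "?L \<le> _ * ?R")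
proof -
  have sub: "emeasure (lebesgue_on I) B = emeasure lebesgue B" if "B \<subseteq> I" for B
    using that I by (simp add: emeasure_restrict_space)
  have setsI: "B \<in> sets (lebesgue_on I) \<longleftrightarrow> B \<in> sets lebesgue" if "B \<subseteq> I" for B
    using that I by (simp add: sets_restrict_space_iff)
  define B where "B k = {s\<in>I. \<mu> k \<le> \<bar>x s\<bar>}" for k
  have BI: "B k \<subseteq> I" for k by (auto simp: B_def)
  have "B k \<in> sets (lebesgue_on I)" for k
    unfolding B_def using L0_sets[OF x, of "\<lambda>v. \<mu> k \<le> \<bar>v\<bar>"] by simp
  then have Bs: "B k \<in> sets lebesgue" for k using setsI[OF BI] by simp
  have mB: "ennreal (2 powr real_of_int k) \<le> emeasure lebesgue (B k)" if "k \<in> F" for k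
    using \<mu>[OF that] sub[OF BI, of k] by (simp add: B_def)
  have "\<exists>A. disjoint_family_on A F \<and> (\<forall>k\<in>F. A k \<in> sets lebesgue \<and> A k \<subseteq> B k
      \<and> emeasure lebesgue (A k) = ennreal (2 powr (real_of_int k - 1)))"
    by (rule disjoint_dyadic_subsets[OF F(1) Bs mB])
  then obtain A where AB: "disjoint_family_on A F" "\<And>k. k \<in> F \<Longrightarrow> A k \<in> sets lebesgue"
     "\<And>k. k \<in> F \<Longrightarrow> A k \<subseteq> B k" "\<And>k. k \<in> F \<Longrightarrow> emeasure lebesgue (A k) = ennreal (2 powr (real_of_int k - 1))"
    by blast
  have AI: "A k \<subseteq> I" if "k \<in> F" for k using AB(3)[OF that] BI by blast
  interpret dyadic_blocks I F A
    using F AB AI setsI sub by unfold_locales auto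
  define y where "y = step b"
  have y: "y \<in> L0 I" by (simp add: y_def step_L0)
  have ystep: "y s = b k" if "k \<in> F" "s \<in> A k" for k s
    using step_eq[OF that] by (simp add: y_def)
  have R: "?R < top"
    using q F by (intro lnorm_finite_less_top) auto
  have Dy: "dyadic_norm I e1 q1 y \<le> ennreal (geometric_const q1 (2 powr - e1)) * ?R"
    unfolding y_def by (rule dyadic_norm_step_le[OF q(1) e1_pos b])
  also have "\<dots> < top"
    using R by (simp add: ennreal_mult_less_top)
  finally have yE: "y \<in> lorentz I p1 q1"
    using y lorentz_iff_dyadic_norm[OF q(1)] by (simp add: e1_def)
  have Ly: "lorentz_norm I p1 q1 y \<le> ennreal (2 powr e1 * geometric_const q1 (2 powr - e1)) * ?R"
    using lorentz_norm_le_dyadic_norm[OF q(1), of I p1 y] mult_left_mono[OF Dy, of "ennreal (2 powr e1)"]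
    by (simp add: e1_def ennreal_mult' mult.assoc)
  have "\<mu> k * b k \<le> \<bar>x s * y s\<bar>" if "k \<in> F" "s \<in> A k" for k s
  proof -
    have "\<mu> k \<le> \<bar>x s\<bar>" using AB(3) that by (auto simp: B_def)
    then show ?thesis using ystep[OF that] b[of k] by (simp add: abs_mult mult_right_mono)
  qed
  then have "?L \<le> ennreal (2 powr (2 * e2)) * dyadic_norm I e2 q2 (\<lambda>s. x s * y s)"
    by (intro lnorm_le_dyadic_norm q L0_mult x y) auto
  also have "\<dots> \<le> ennreal (2 powr (2 * e2)) *
     (ennreal ((if q2 = top then 1 else 2 powr (1 / enn2real q2)) * 2 powr e2)
        * lorentz_norm I p2 q2 (\<lambda>s. x s * y s))"
    unfolding e2_def by (intro mult_left_mono dyadic_norm_le_lorentz_norm q) simp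
  finally have L: "?L \<le> ennreal (2 powr (2 * e2)) *
     (ennreal ((if q2 = top then 1 else 2 powr (1 / enn2real q2)) * 2 powr e2)
        * lorentz_norm I p2 q2 (\<lambda>s. x s * y s))" .
  show ?thesis
  \<comment> \<open>A step function of quasi-norm 0 cannot be normalized; there all coefficients
    vanish and the left side is 0.\<close>
  proof (cases "lorentz_norm I p1 q1 y = 0")
    case True
    then have "dyadic_norm I e1 q1 y = 0"
      using dyadic_norm_le_lorentz_norm[OF q(1), of I p1 y] by (simp add: e1_def)
    then have "?R \<le> 0"
      using lnorm_le_dyadic_norm[OF q(1) y, of b e1] ystep b by simp
    then have "ennreal (2 powr (e1 * real_of_int k) * b k) \<le> 0" if "k \<in> F" for k
      using order_trans[OF lnorm_ge_point[OF q(1) that]] by blast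
    then have "b k = 0" if "k \<in> F" for k
      using that b[of k] by (fastforce simp: ennreal_eq_0_iff mult_le_0_iff)
    then have "?L \<le> lnorm q2 F (\<lambda>k. 0 * 0)"
      using q by (intro lnorm_mono) auto
    also have "\<dots> = 0"
      using q by (subst lnorm_cmult) auto
    finally show ?thesis by simp
  next
    case False
    then have "0 < lorentz_norm I p1 q1 y" by (simp add: zero_less_iff_neq_zero)
    from lorentz_norm_mult_le[OF x yE this]
    have "lorentz_norm I p2 q2 (\<lambda>s. x s * y s)
        \<le> Mnorm x * (ennreal (2 powr e1 * geometric_const q1 (2 powr - e1)) * ?R)"
      using mult_left_mono[OF Ly, of "Mnorm x"] by (rule order_trans) simp
    then have "?L \<le> ennreal (2 powr (2 * e2)) *
       (ennreal ((if q2 = top then 1 else 2 powr (1 / enn2real q2)) * 2 powr e2)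
        * (Mnorm x * (ennreal (2 powr e1 * geometric_const q1 (2 powr - e1)) * ?R)))"
      by (intro order_trans[OF L] mult_left_mono) auto
    also have "\<dots> = ennreal test_const * Mnorm x * ?R"
    proof -
      have *: "ennreal (c1 * c2 * c3) = ennreal c1 * (ennreal c2 * ennreal c3)" if "0 \<le> c1" "0 \<le> c2" for c1 c2 c3
        using that by (simp add: ennreal_mult' mult.assoc)
      have "ennreal test_const = ennreal (2 powr (2 * e2)) *
         (ennreal ((if q2 = top then 1 else 2 powr (1 / enn2real q2)) * 2 powr e2)
          * ennreal (2 powr e1 * geometric_const q1 (2 powr - e1)))"
        unfolding test_const_def by (rule *) auto
      then show ?thesis by (simp only: mult_ac)
    qed
    finally show ?thesis .
  qed
qed

end

lemma dyadic_norm_le_const: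
  assumes "0 < q"
  shows "\<exists>C>0. \<forall>x. dyadic_norm I (enn2real (1 / p)) q x \<le> ennreal C * lorentz_norm I p q x"
  using dyadic_norm_le_lorentz_norm[OF assms, of I p]
  by (intro exI[of _ "(if q = top then 1 else 2 powr (1 / enn2real q)) * 2 powr enn2real (1 / p)"]) auto

section \<open>The two inclusions, and the vanishing of multipliers\<close>

context lorentz_multipliers
begin

text \<open>The test on a single block with coefficient 1, stated in the reals.\<close>

lemma level_le_Mnorm:
  assumes "x \<in> L0 I" "k \<in> dyadic_indices I" "Mnorm x < top" "0 \<le> c"
    and "ennreal (2 powr real_of_int k) \<le> emeasure (lebesgue_on I) {s\<in>I. c \<le> \<bar>x s\<bar>}"
  shows "2 powr (e2 * real_of_int k) * c \<le> test_const * enn2real (Mnorm x) * 2 powr (e1 * real_of_int k)"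
proof -
  obtain m where m: "0 \<le> m" "Mnorm x = ennreal m" using assms(3) by (cases "Mnorm x") auto
  have "ennreal (2 powr (e2 * real_of_int k) * c) \<le> ennreal test_const * Mnorm x * ennreal (2 powr (e1 * real_of_int k))"
    using lnorm_mult_le_Mnorm[OF assms(1), of "{k}" "\<lambda>_. c" "\<lambda>_. 1"] assms q by simp
  also have "\<dots> = ennreal (test_const * m * 2 powr (e1 * real_of_int k))"
    using m test_const_pos by (simp add: ennreal_mult)
  finally show ?thesis using m test_const_pos by (simp add: ennreal_le_iff2 split: if_splits) (smt (verit) mult_nonneg_nonneg powr_ge_zero)
qed

text \<open>With levels at half the rearrangement of \<open>x\<close>, the test bounds the products
  of \<open>u\<close> with every sequence \<open>v\<close>, and the converse of Hoelder turns this
  into a bound on \<open>u\<close> over finite index sets. The factor 2 restores the halved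
  levels.\<close>

lemma dyadic_norm_le_Mnorm:
  assumes x: "x \<in> L0 I" and e: "e2 = e3 + e1"
    and q3: "0 < q3" "1 / q3 = (if q1 > q2 then 1 / q2 - 1 / q1 else 0)"
  shows "dyadic_norm I e3 q3 x \<le> ennreal (2 * test_const) * Mnorm x"
proof (cases "Mnorm x < top")
  case False
  then have "Mnorm x = top" using less_top by blast
  then show ?thesis using test_const_pos by (simp add: ennreal_mult_top)
next
  case True
  define a where "a k = rearrangement I x (2 powr real_of_int k)" for k :: int
  define B where "B = ennreal test_const * Mnorm x"
  have B: "B < top" using True by (simp add: B_def ennreal_mult_less_top)
  have afin: "a k < top" if k: "k \<in> dyadic_indices I" for k
  proof (rule ccontr)
    assume "\<not> ?thesis"
    then have top: "a k = top" using less_top by blast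
    \<comment> \<open>\<beta> is the largest level that the single-block test permits at scale
      \<open>k\<close>. An infinite rearrangement would admit the level
      \<open>\<beta> + 1\<close>.\<close>
    define \<beta> where "\<beta> = test_const * enn2real (Mnorm x) * 2 powr (e1 * real_of_int k) / 2 powr (e2 * real_of_int k)"
    have \<beta>: "0 \<le> \<beta>" using test_const_pos by (simp add: \<beta>_def)
    have "2 powr (e2 * real_of_int k) * (\<beta> + 1) \<le> test_const * enn2real (Mnorm x) * 2 powr (e1 * real_of_int k)"
      using top \<beta> unfolding a_def
      by (intro level_le_Mnorm[OF x k True] emeasure_ge_if_less_rearrangement[OF x]) auto
    then have "\<beta> + 1 \<le> \<beta>" by (simp add: \<beta>_def field_simps)
    then show False by simp
  qed
  \<comment> \<open>Half of a positive finite value lies strictly below it, as needed to get a level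
    set of measure at least \<open>2^k\<close>. If the value is 0, the level set is all of
    \<open>I\<close>.\<close>
  define \<mu> where "\<mu> k = enn2real (a k) / 2" for k
  define u where "u k = 2 powr (e3 * real_of_int k) * \<mu> k" for k :: int
  have "lnorm q3 F (\<lambda>k. ennreal (2 powr (e3 * real_of_int k)) * a k) \<le> 2 * B"
    if F: "finite F" "F \<subseteq> dyadic_indices I" for F
  proof -
    have level: "ennreal (2 powr real_of_int k) \<le> emeasure (lebesgue_on I) {s\<in>I. \<mu> k \<le> \<bar>x s\<bar>}" if kF: "k \<in> F" for k
    proof (cases "a k = 0")
      case True
      then have "{s\<in>I. \<mu> k \<le> \<bar>x s\<bar>} = I" by (simp add: \<mu>_def)
      then show ?thesis using F kF I by (auto simp: emeasure_restrict_space dyadic_indices_def)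
    next
      case False
      obtain r where "0 \<le> r" "a k = ennreal r" using afin[of k] F kF by (cases "a k") auto
      with False show ?thesis
        by (intro emeasure_ge_if_less_rearrangement[OF x]) (auto simp: \<mu>_def ennreal_less_iff simp flip: a_def)
    qed
    have "lnorm q3 F (\<lambda>k. ennreal (u k)) \<le> B"
    proof (rule lnorm_dual[OF q q3(2) F(1) B])
      show "0 \<le> u k" for k by (simp add: u_def \<mu>_def)
      fix v :: "int \<Rightarrow> real" assume v: "\<And>k. 0 \<le> v k"
      \<comment> \<open>Cancels the weight at exponent \<open>e1\<close>, so the right side of the
        test sees \<open>v\<close>; the left side then sees \<open>u k * v k\<close>, by
        \<open>e2 = e3 + e1\<close>.\<close>
      define b where "b k = 2 powr - (e1 * real_of_int k) * v k" for k
      have "2 powr (e2 * real_of_int k) * (\<mu> k * b k) = u k * v k" for k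
        by (simp add: b_def u_def e algebra_simps flip: powr_add)
      moreover have "2 powr (e1 * real_of_int k) * b k = v k" for k
        by (simp add: b_def powr_minus)
      moreover have "0 \<le> b k" for k using v by (simp add: b_def)
      ultimately show "lnorm q2 F (\<lambda>k. ennreal (u k * v k)) \<le> B * lnorm q1 F (\<lambda>k. ennreal (v k))"
        using lnorm_mult_le_Mnorm[OF x F level, of b] by (simp add: B_def)
    qed
    then have "2 * lnorm q3 F (\<lambda>k. ennreal (u k)) \<le> 2 * B" by (rule mult_left_mono) simp
    moreover have "ennreal (2 powr (e3 * real_of_int k)) * a k = 2 * ennreal (u k)" if kF: "k \<in> F" for k
    proof -
      obtain r where "0 \<le> r" "a k = ennreal r" using afin[of k] F kF by (cases "a k") auto
      then show ?thesis by (simp add: u_def \<mu>_def ennreal_mult[symmetric] flip: ennreal_numeral)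
    qed
    then have "lnorm q3 F (\<lambda>k. ennreal (2 powr (e3 * real_of_int k)) * a k) = lnorm q3 F (\<lambda>k. 2 * ennreal (u k))"
      by (rule lnorm_cong)
    ultimately show ?thesis by (simp add: lnorm_cmult[OF q3(1)])
  qed
  then have "dyadic_norm I e3 q3 x \<le> 2 * B"
    unfolding dyadic_norm_def a_def by (rule lnorm_le_if_finite_le[OF q3(1)])
  then show ?thesis
    using test_const_pos by (simp add: B_def ennreal_mult mult.assoc)
qed

text \<open>Both claims are the dyadic product estimate, translated to Lorentz quasi-norms at the
  three exponent pairs.\<close>

lemma lorentz_multiplier:
  assumes e: "e2 = enn2real (1 / p3) + e1"
    and q3: "0 < q3" "1 / q3 = (if q1 > q2 then 1 / q2 - 1 / q1 else 0)"
  shows "\<exists>C>0. \<forall>x\<in>lorentz I p3 q3. Mnorm x \<le> ennreal C * lorentz_norm I p3 q3 x"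
    and "lorentz I p3 q3 \<subseteq> M"
proof -
  define e3 where "e3 = enn2real (1 / p3)"
  obtain c1 where c1: "0 < c1" "\<And>z. dyadic_norm I e1 q1 z \<le> ennreal c1 * lorentz_norm I p1 q1 z"
    using dyadic_norm_le_const[OF q(1), of I p1] unfolding e1_def by blast
  obtain c3 where c3: "0 < c3" "\<And>z. dyadic_norm I e3 q3 z \<le> ennreal c3 * lorentz_norm I p3 q3 z"
    using dyadic_norm_le_const[OF q3(1), of I p3] unfolding e3_def by blast
  define h where "h = 2 powr e2 * (2 powr e2 * 2 powr (1 / enn2real q2))"
  have h: "0 < h" by (simp add: h_def)
  have bound: "lorentz_norm I p2 q2 (\<lambda>s. x s * y s) \<le> ennreal (h * (\<alpha> * \<beta>))"
    if x: "x \<in> L0 I" "dyadic_norm I e3 q3 x \<le> ennreal \<alpha>" and y: "y \<in> L0 I" "dyadic_norm I e1 q1 y \<le> ennreal \<beta>"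
      and ab: "0 < \<alpha>" "0 < \<beta>" for x y \<alpha> \<beta>
  proof -
    have "lorentz_norm I p2 q2 (\<lambda>s. x s * y s) \<le> ennreal (2 powr e2) * dyadic_norm I e2 q2 (\<lambda>s. x s * y s)"
      unfolding e2_def by (rule lorentz_norm_le_dyadic_norm[OF q(2)])
    also have "\<dots> \<le> ennreal (2 powr e2) * ennreal (2 powr e2 * 2 powr (1 / enn2real q2) * (\<alpha> * \<beta>))"
      using e by (intro mult_left_mono dyadic_norm_mult_le[OF q q3(2,1) _ ab x y]) (auto simp: e3_def)
    also have "\<dots> = ennreal (h * (\<alpha> * \<beta>))"
      by (simp add: h_def mult.assoc flip: ennreal_mult')
    finally show ?thesis .
  qed
  have "Mnorm x \<le> ennreal (h * (c3 * c1)) * lorentz_norm I p3 q3 x" if x: "x \<in> lorentz I p3 q3" for x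
  proof -
    have xL: "x \<in> L0 I" "lorentz_norm I p3 q3 x < top" using x by (auto simp: lorentz_def)
    then obtain n where n: "0 \<le> n" "lorentz_norm I p3 q3 x = ennreal n"
      by (cases "lorentz_norm I p3 q3 x") auto
    show ?thesis
    proof (rule ennreal_le_epsilon)
      fix \<epsilon> :: real assume \<epsilon>: "0 < \<epsilon>"
      \<comment> \<open>The product estimate takes strictly positive bounds, so \<open>n\<close>,
        possibly 0, is replaced by \<open>n + \<delta>\<close>; this \<delta> makes the excess
        exactly \<epsilon>.\<close>
      define \<delta> where "\<delta> = \<epsilon> / (h * (c3 * c1))"
      have \<delta>: "0 < \<delta>" using \<epsilon> h c1(1) c3(1) by (simp add: \<delta>_def)
      have "Mnorm x \<le> ennreal (h * ((c3 * (n + \<delta>)) * c1))"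
        unfolding multiplier_norm_def
      proof (rule SUP_least)
        fix y assume y: "y \<in> {y \<in> lorentz I p1 q1. lorentz_norm I p1 q1 y = 1}"
        have "dyadic_norm I e3 q3 x \<le> ennreal (c3 * n)"
          using c3(2)[of x] n c3(1) by (simp add: ennreal_mult)
        also have "\<dots> \<le> ennreal (c3 * (n + \<delta>))"
          using c3(1) \<delta> by (intro ennreal_leI mult_left_mono) auto
        finally have "dyadic_norm I e3 q3 x \<le> ennreal (c3 * (n + \<delta>))" .
        moreover have "dyadic_norm I e1 q1 y \<le> ennreal c1" using c1(2)[of y] y by simp
        moreover have "y \<in> L0 I" using y by (simp add: lorentz_def)
        ultimately show "lorentz_norm I p2 q2 (\<lambda>s. x s * y s) \<le> ennreal (h * ((c3 * (n + \<delta>)) * c1))"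
          using c1(1) c3(1) n(1) \<delta> xL by (intro bound) auto
      qed
      also have "h * ((c3 * (n + \<delta>)) * c1) = h * (c3 * c1) * n + \<epsilon>"
        using h c1(1) c3(1) by (simp add: \<delta>_def field_simps)
      finally show "Mnorm x \<le> ennreal (h * (c3 * c1)) * lorentz_norm I p3 q3 x + ennreal \<epsilon>"
        using n h c1(1) c3(1) \<epsilon> by (simp add: ennreal_mult[symmetric] flip: ennreal_plus)
    qed
  qed
  moreover have "0 < h * (c3 * c1)" using h c1(1) c3(1) by simp
  ultimately show "\<exists>C>0. \<forall>x\<in>lorentz I p3 q3. Mnorm x \<le> ennreal C * lorentz_norm I p3 q3 x" by blast
  show "lorentz I p3 q3 \<subseteq> M"
  proof
    fix x assume x: "x \<in> lorentz I p3 q3"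
    have xL: "x \<in> L0 I" "dyadic_norm I e3 q3 x < top"
      using x lorentz_iff_dyadic_norm[OF q3(1)] by (auto simp: e3_def)
    have "(\<lambda>t. x t * y t) \<in> lorentz I p2 q2" if y: "y \<in> lorentz I p1 q1" for y
    proof -
      have yL: "y \<in> L0 I" "dyadic_norm I e1 q1 y < top"
        using y lorentz_iff_dyadic_norm[OF q(1)] by (auto simp: e1_def)
      obtain \<alpha> where \<alpha>: "0 < \<alpha>" "dyadic_norm I e3 q3 x \<le> ennreal \<alpha>"
        using xL(2) by (cases "dyadic_norm I e3 q3 x") (auto intro!: that[of "enn2real (dyadic_norm I e3 q3 x) + 1"])
      obtain \<beta> where \<beta>: "0 < \<beta>" "dyadic_norm I e1 q1 y \<le> ennreal \<beta>"
        using yL(2) by (cases "dyadic_norm I e1 q1 y") (auto intro!: that[of "enn2real (dyadic_norm I e1 q1 y) + 1"])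
      have "lorentz_norm I p2 q2 (\<lambda>s. x s * y s) < top"
        by (rule le_less_trans[OF bound[OF xL(1) \<alpha>(2) yL(1) \<beta>(2) \<alpha>(1) \<beta>(1)]]) simp
      then show ?thesis using L0_mult[OF xL(1) yL(1)] by (simp add: lorentz_def)
    qed
    then show "x \<in> M" using xL(1) by (simp add: multipliers_def)
  qed
qed

text \<open>If \<open>x\<close> is not null, some level set with \<open>c > 0\<close> has measure at
  least \<open>2^k\<close>, hence at least \<open>2^j\<close> for all \<open>j \<le> k\<close>, and
  small scales can be tested. For \<open>e2 < e1\<close> a single block suffices as \<open>j\<close>
  decreases; for \<open>e1 = e2\<close>, many blocks compare powers of their number with exponents
  \<open>1 / q2\<close> and \<open>1 / q1\<close>.\<close>

lemma multiplier_AE_zero: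
  assumes x: "x \<in> M" and e: "e2 < e1 \<or> e1 = e2 \<and> q2 < q1"
  shows "AE s in lebesgue_on I. x s = 0"
proof (rule ccontr)
  assume not0: "\<not> ?thesis"
  have xL: "x \<in> L0 I" using x by (simp add: multipliers_def)
  have fin: "Mnorm x < top" by (rule Mnorm_finite[OF x])
  define N where "N = {s\<in>I. 0 < \<bar>x s\<bar>}"
  have N: "N \<in> sets (lebesgue_on I)" unfolding N_def by (rule superlevel_sets[OF xL])
  have "0 < emeasure (lebesgue_on I) N"
  proof (rule ccontr)
    assume "\<not> ?thesis"
    then have "AE s in lebesgue_on I. x s = 0"
      using N by (intro AE_I[of _ _ N]) (auto simp: N_def)
    with not0 show False by simp
  qed
  then obtain z where z: "0 < z" "z < emeasure (lebesgue_on I) N" using dense by blast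
  then obtain r where r: "0 < r" "ennreal r < emeasure (lebesgue_on I) N"
    by (cases z) auto
  from dyadic_floor[OF r(1)] obtain k :: int where "2 powr real_of_int k \<le> r" by blast
  with r(2) have k: "ennreal (2 powr real_of_int k) < emeasure (lebesgue_on I) N"
    using le_less_trans ennreal_leI by blast
  have "emeasure (lebesgue_on I) N \<le> emeasure (lebesgue_on I) (space (lebesgue_on I))"
    by (rule emeasure_space)
  with k have kI: "k \<in> dyadic_indices I"
    using I by (auto simp: emeasure_restrict_space dyadic_indices_def)
  have "0 < rearrangement I x (2 powr real_of_int k)"
    using rearrangement_le_iff[OF xL, of 0 "2 powr real_of_int k"] k by (auto simp: N_def not_le[symmetric])
  then obtain z' where z': "0 < z'" "z' < rearrangement I x (2 powr real_of_int k)" using dense by blast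
  then obtain c where c: "0 < c" "ennreal c < rearrangement I x (2 powr real_of_int k)"
    by (cases z') auto
  have level: "ennreal (2 powr real_of_int j) \<le> emeasure (lebesgue_on I) {s\<in>I. c \<le> \<bar>x s\<bar>}" if "j \<le> k" for j
  proof -
    have "ennreal (2 powr real_of_int j) \<le> ennreal (2 powr real_of_int k)"
      using that by (intro ennreal_leI) simp
    also have "\<dots> \<le> emeasure (lebesgue_on I) {s\<in>I. c \<le> \<bar>x s\<bar>}"
      using c by (intro emeasure_ge_if_less_rearrangement[OF xL]) auto
    finally show ?thesis .
  qed
  define \<beta> where "\<beta> = test_const * enn2real (Mnorm x)"
  have \<beta>: "0 \<le> \<beta>" using test_const_pos by (simp add: \<beta>_def)
  have \<beta>_eq: "ennreal test_const * Mnorm x = ennreal \<beta>"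
    using fin test_const_pos by (cases "Mnorm x") (auto simp: \<beta>_def ennreal_mult)
  from e show False
  proof (elim disjE conjE)
    assume less: "e2 < e1"
    define \<theta> where "\<theta> = 2 powr (e2 - e1)"
    have \<theta>: "0 < \<theta>" "\<theta> < 1" using less powr_less_mono[of "e2 - e1" 0 2] by (auto simp: \<theta>_def)
    \<comment> \<open>The added 1 makes \<gamma> positive, so that \<open>c / \<gamma>\<close> is a
      valid target also when \<beta> is 0.\<close>
    define \<gamma> where "\<gamma> = \<beta> * 2 powr ((e1 - e2) * real_of_int k) + 1"
    have \<gamma>: "0 < \<gamma>" using \<beta> by (simp add: \<gamma>_def add_nonneg_pos)
    obtain n where n: "\<theta> ^ n < c / \<gamma>"
      using real_arch_pow_inv[of "c / \<gamma>" \<theta>] \<theta> \<gamma> c by auto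
    define j where "j = k - int n"
    have "2 powr (e2 * real_of_int j) * c \<le> \<beta> * 2 powr (e1 * real_of_int j)"
      using dyadic_indices_antimono[OF kI, of j] c level[of j] unfolding \<beta>_def
      by (intro level_le_Mnorm[OF xL _ fin]) (auto simp: j_def)
    then have "2 powr - (e2 * real_of_int j) * (2 powr (e2 * real_of_int j) * c)
       \<le> 2 powr - (e2 * real_of_int j) * (\<beta> * 2 powr (e1 * real_of_int j))"
      by (rule mult_left_mono) simp
    then have "c \<le> \<beta> * 2 powr ((e1 - e2) * real_of_int j)"
      by (simp add: powr_minus algebra_simps powr_diff field_simps)
    also have "2 powr ((e1 - e2) * real_of_int j) = 2 powr ((e1 - e2) * real_of_int k) * \<theta> ^ n"
      using \<theta> by (simp add: \<theta>_def j_def algebra_simps powr_powr flip: powr_realpow powr_add)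
    also have "\<beta> * (2 powr ((e1 - e2) * real_of_int k) * \<theta> ^ n) \<le> \<gamma> * \<theta> ^ n"
      using \<theta> by (simp add: \<gamma>_def mult.assoc[symmetric] mult_right_mono)
    also have "\<gamma> * \<theta> ^ n < c"
      using n \<gamma> by (simp add: pos_less_divide_eq mult.commute)
    finally show False by simp
  next
    assume eq: "e1 = e2" and "q2 < q1"
    then obtain r2 where r2: "0 < r2" "q2 = ennreal r2" using q by (cases q2) auto
    \<comment> \<open>\<open>s\<close> is \<open>1 / q1\<close>, read as 0 for infinite
      \<open>q1\<close>.\<close>
    obtain s where s: "s < 1 / r2"
      and l1: "\<And>F :: int set. finite F \<Longrightarrow> F \<noteq> {} \<Longrightarrow> lnorm q1 F (\<lambda>k. 1) \<le> ennreal (real (card F) powr s)"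
    proof (cases q1)
      case top
      show ?thesis by (rule that[of 0]) (use r2 top in \<open>auto simp: lnorm_top\<close>)
    next
      case (real r1)
      then have r1: "0 < r1" "r2 < r1" using \<open>q2 < q1\<close> q r2 by (auto simp: ennreal_less_iff)
      show ?thesis
        by (rule that[of "1 / r1"])
           (use r1 r2 real in \<open>auto simp: lnorm_ennreal nn_integral_count_space_finite frac_less2
              ennreal_of_nat_eq_real_of_nat\<close>)
    qed
    define d where "d = 1 / r2 - s"
    have d: "0 < d" using s by (simp add: d_def)
    \<comment> \<open>The test on \<open>n\<close> blocks will give
      \<open>c * n powr d \<le> \<beta>\<close>; this \<open>n\<close> violates it.\<close>
    obtain n :: nat where n: "(\<beta> / c + 1) powr (1 / d) < real n" using reals_Archimedean2 by blast
    have n0: "0 < n" using n by (cases n) (auto simp: not_less[symmetric])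
    define F where "F = {k - int n <.. k}"
    have F: "finite F" "card F = n" "F \<noteq> {}" "F \<subseteq> dyadic_indices I"
      using n0 dyadic_indices_antimono[OF kI] by (auto simp: F_def)
    \<comment> \<open>The coefficients remove the weights, which agree on both sides as
      \<open>e1 = e2\<close>: constant sequences remain.\<close>
    have "lnorm q2 F (\<lambda>k. ennreal (2 powr (e2 * real_of_int k) * (c * 2 powr - (e2 * real_of_int k))))
      \<le> ennreal test_const * Mnorm x * lnorm q1 F (\<lambda>k. ennreal (2 powr (e1 * real_of_int k) * 2 powr - (e2 * real_of_int k)))"
      by (rule lnorm_mult_le_Mnorm[OF xL F(1,4)]) (use level in \<open>auto simp: F_def\<close>)
    also have "(\<lambda>k::int. ennreal (2 powr (e2 * real_of_int k) * (c * 2 powr - (e2 * real_of_int k)))) = (\<lambda>k. ennreal c * 1)"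
      by (simp add: powr_minus field_simps)
    also have "(\<lambda>k::int. ennreal (2 powr (e1 * real_of_int k) * 2 powr - (e2 * real_of_int k))) = (\<lambda>k. 1)"
      by (simp add: eq powr_minus)
    also have "lnorm q2 F (\<lambda>k. ennreal c * 1) = ennreal (c * real n powr (1 / r2))"
      using c r2 F by (subst lnorm_cmult)
        (auto simp: lnorm_ennreal nn_integral_count_space_finite ennreal_of_nat_eq_real_of_nat ennreal_mult)
    finally have "ennreal (c * real n powr (1 / r2)) \<le> ennreal \<beta> * lnorm q1 F (\<lambda>k. 1)"
      unfolding \<beta>_eq .
    also have "\<dots> \<le> ennreal \<beta> * ennreal (real n powr s)"
      using l1[OF F(1,3)] F(2) by (intro mult_left_mono) auto
    finally have "c * real n powr (1 / r2) \<le> \<beta> * real n powr s"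
      using \<beta> by (simp add: ennreal_mult[symmetric])
    moreover have "real n powr (1 / r2) = real n powr d * real n powr s"
      using n0 by (simp add: d_def flip: powr_add)
    ultimately have "c * real n powr d \<le> \<beta>"
      using n0 by (simp add: mult.assoc[symmetric])
    then have "real n powr d \<le> \<beta> / c" using c by (simp add: field_simps)
    moreover have "((\<beta> / c + 1) powr (1 / d)) powr d < real n powr d"
      using n d by (intro powr_less_mono2) auto
    then have "\<beta> / c + 1 < real n powr d"
      using d \<beta> c by (simp add: powr_powr)
    ultimately show False by simp
  qed
qed

lemma AE_zero_multiplier:
  assumes x: "x \<in> L0 I" "AE s in lebesgue_on I. x s = 0"
  shows "x \<in> M"
proof -
  have "(\<lambda>t. x t * y t) \<in> lorentz I p2 q2" if "y \<in> lorentz I p1 q1" for y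
  proof -
    have y: "y \<in> L0 I" using that by (simp add: lorentz_def)
    have "AE s in lebesgue_on I. x s * y s = 0" using x(2) by eventually_elim simp
    then have "rearrangement I (\<lambda>t. x t * y t) t = 0" for t
      by (rule rearrangement_AE_zero[OF _ L0_mult[OF x(1) y]])
    then have "dyadic_norm I (enn2real (1 / p2)) q2 (\<lambda>t. x t * y t) = 0"
      using lnorm_cmult[OF q(2), of "dyadic_indices I" 0 "\<lambda>_. 0"] by (simp add: dyadic_norm_def)
    then show ?thesis
      using lorentz_iff_dyadic_norm[OF q(2)] L0_mult[OF x(1) y] by simp
  qed
  then show ?thesis using x by (simp add: multipliers_def)
qed

end

text \<open>Subtraction in \<open>ennreal\<close> is truncated; \<open>p2 \<le> p1\<close> makes the
  difference of reciprocals exact, so it becomes an identity of reals.\<close>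

lemma enn2real_inverse_add:
  fixes p1 p2 p3 :: ennreal
  assumes "0 < p1" "0 < p2" "p2 \<le> p1" "1 / p3 = 1 / p2 - 1 / p1"
  shows "enn2real (1 / p2) = enn2real (1 / p3) + enn2real (1 / p1)"
proof -
  have fin: "1 / p1 \<noteq> top" "1 / p2 \<noteq> top"
    using assms by (auto simp: divide_ennreal_def ennreal_inverse_eq_top_iff)
  have "1 / p1 \<le> 1 / p2"
    using assms by (cases p1; cases p2) (auto simp: divide_ennreal_def inverse_ennreal le_imp_inverse_le top_unique)
  with fin assms(4) show ?thesis
    by (cases "1 / p1"; cases "1 / p2") (auto simp: ennreal_minus)
qed

theorem theorem4:
  fixes p1 p2 q1 q2 :: ennreal and I :: "real set"
  assumes "0 < p1" "p1 < \<infinity>" "0 < p2" "p2 < \<infinity>" "0 < q1" "0 < q2"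
    and "I = {0<..<1} \<or> I = {0<..}"
  shows
    "(p1 < p2 \<or> (p1 = p2 \<and> q1 > q2) \<longrightarrow>
        multipliers I (lorentz I p1 q1) (lorentz I p2 q2)
          = {x \<in> L0 I. AE t in lebesgue_on I. x t = 0})
     \<and>
     (p1 > p2 \<or> (p1 = p2 \<and> q1 \<le> q2) \<longrightarrow>
        (\<forall>p3 q3 :: ennreal.
           1 / p3 = 1 / p2 - 1 / p1 \<and> 1 / q3 = (if q1 > q2 then 1 / q2 - 1 / q1 else 0) \<longrightarrow>
             multipliers I (lorentz I p1 q1) (lorentz I p2 q2) = lorentz I p3 q3
           \<and> equivalent_on (lorentz I p3 q3)
               (multiplier_norm (lorentz I p1 q1) (lorentz_norm I p1 q1) (lorentz_norm I p2 q2))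
               (lorentz_norm I p3 q3)))"
proof -
  have I: "I \<in> sets lebesgue" using assms(7) by auto
  interpret lorentz_multipliers I p1 p2 q1 q2
    using I assms by unfold_locales
  show ?thesis
  proof (intro conjI impI allI)
    assume *: "p1 < p2 \<or> (p1 = p2 \<and> q1 > q2)"
    have "e2 < e1" if "p1 < p2"
    proof -
      obtain a b where "0 < a" "p1 = ennreal a" "0 < b" "p2 = ennreal b"
        using assms by (cases p1; cases p2) auto
      with that show ?thesis
        unfolding e1_def e2_def
        by (simp add: divide_ennreal frac_less2 ennreal_less_iff flip: ennreal_1)
    qed
    with * have "e2 < e1 \<or> e1 = e2 \<and> q2 < q1" by (auto simp: e1_def e2_def)
    then show "M = {x \<in> L0 I. AE t in lebesgue_on I. x t = 0}"
      using multiplier_AE_zero AE_zero_multiplier by (auto simp: multipliers_def)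
  next
    fix p3 q3 :: ennreal
    assume *: "p1 > p2 \<or> (p1 = p2 \<and> q1 \<le> q2)"
      and p3q3: "1 / p3 = 1 / p2 - 1 / p1 \<and> 1 / q3 = (if q1 > q2 then 1 / q2 - 1 / q1 else 0)"
    define e3 where "e3 = enn2real (1 / p3)"
    have e: "e2 = e3 + e1"
      unfolding e1_def e2_def e3_def using assms * p3q3 by (intro enn2real_inverse_add) auto
    have q3: "1 / q3 = (if q1 > q2 then 1 / q2 - 1 / q1 else 0)" using p3q3 by blast
    have q3_pos: "0 < q3"
      using q q3 by (cases rule: dual_exponent_cases) auto
    note up = lorentz_multiplier[OF e[unfolded e3_def] q3_pos q3]
    have low: "dyadic_norm I e3 q3 x \<le> ennreal (2 * test_const) * Mnorm x" if "x \<in> L0 I" for x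
      by (rule dyadic_norm_le_Mnorm[OF that e q3_pos q3])
    show "M = lorentz I p3 q3"
    proof
      \<comment> \<open>The lower estimate yields membership because a multiplier has finite
        multiplier quasi-norm.\<close>
      show "M \<subseteq> lorentz I p3 q3"
      proof
        fix x assume x: "x \<in> M"
        then have xL: "x \<in> L0 I" by (simp add: multipliers_def)
        have "dyadic_norm I e3 q3 x < top"
          by (rule le_less_trans[OF low[OF xL]]) (use Mnorm_finite[OF x] in \<open>simp add: ennreal_mult_less_top\<close>)
        then show "x \<in> lorentz I p3 q3"
          using xL lorentz_iff_dyadic_norm[OF q3_pos] by (simp add: e3_def)
      qed
    qed (rule up(2))
    obtain C where C: "0 < C" "\<And>x. x \<in> lorentz I p3 q3 \<Longrightarrow> Mnorm x \<le> ennreal C * lorentz_norm I p3 q3 x"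
      using up(1) by blast
    \<comment> \<open>\<open>2 powr e3\<close> comes from the passage from dyadic to Lorentz
      quasi-norm, the rest from the lower estimate; \<open>1 / d\<close> and \<open>C\<close> are
      the equivalence constants.\<close>
    define d where "d = 2 powr e3 * (2 * test_const)"
    have d: "0 < d" using test_const_pos by (simp add: d_def)
    have "ennreal (1 / d) * lorentz_norm I p3 q3 x \<le> Mnorm x" if "x \<in> lorentz I p3 q3" for x
    proof -
      have xL: "x \<in> L0 I" using that by (simp add: lorentz_def)
      have "lorentz_norm I p3 q3 x \<le> ennreal (2 powr e3) * dyadic_norm I e3 q3 x"
        unfolding e3_def by (rule lorentz_norm_le_dyadic_norm[OF q3_pos])
      also have "\<dots> \<le> ennreal (2 powr e3) * (ennreal (2 * test_const) * Mnorm x)"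
        by (intro mult_left_mono low[OF xL]) simp
      also have "\<dots> = ennreal d * Mnorm x"
        by (simp add: d_def ennreal_mult' mult.assoc)
      finally have "ennreal (1 / d) * lorentz_norm I p3 q3 x \<le> ennreal (1 / d) * (ennreal d * Mnorm x)"
        by (rule mult_left_mono) simp
      also have "\<dots> = Mnorm x"
        using d by (simp add: mult.assoc[symmetric] ennreal_mult[symmetric])
      finally show ?thesis .
    qed
    then show "equivalent_on (lorentz I p3 q3) Mnorm (lorentz_norm I p3 q3)"
      unfolding equivalent_on_def using C d by (intro exI[of _ "1 / d"] exI[of _ C]) auto
  qed
qed

end
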